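(* Let $N$ be a simply connected $6$-dimensional (real) nilpotent Lie group endowed with an abelian complex structure $J'$. Then $(N,J')$ admits a minimal metric, with the only exception of $(N_5,J)$: that is, $(N,J')$ admits a minimal compatible left invariant metric if and only if $(N,J')$ is not holomorphically isomorphic to $(N_5,J)$. Here $N_5$ is the simply connected nilpotent Lie group whose Lie algebra is $\mathbb{R}^6$ with basis $e_1,\dots,e_6$ and Lie bracket determined by $$\mu_5(e_1,e_2)=e_5,\qquad \mu_5(e_1,e_4)=-e_6,\qquad \mu_5(e_2,e_3)=e_6$$ (all other brackets of basis elements $e_i,e_j$, $i<j$, being zero), and $J$ is given by $Je_1=e_2$, $Je_3=e_4$, $Je_5=e_6$, $J^2=-I$.
   Context: Let $N$ be a simply connected nilpotent Lie group of even dimension with Lie algebra $\mathfrak{n}$ and bracket $\mu$. An (invariant) complex structure on $N$ is a linear map $J:\mathfrak{n}\to\mathfrak{n}$ with $J^2=-I$ and $\mu(JX,JY)=\mu(X,Y)+J\mu(JX,Y)+J\mu(X,JY)$ for all $X,Y\in\mathfrak{n}$. It is abelian if $\mu(JX,JY)=\mu(X,Y)$ for all $X,Y\in\mathfrak{n}$. Two pairs $(N_1,J_1)$, $(N_2,J_2)$ are holomorphically isomorphic if there is a Lie algebra isomorphism $\alpha:\mathfrak{n}_1\to\mathfrak{n}_2$ with $J_2=\alpha J_1\alpha^{-1}$. A left invariant Riemannian metric on $N$, given by an inner product $\langle\cdot,\cdot\rangle$ on $\mathfrak{n}$, is compatible with $(N,J)$ if $\langle JX,JY\rangle=\langle X,Y\rangle$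 for all $X,Y\in\mathfrak{n}$. Let $\mathrm{Ric}_{\langle\cdot,\cdot\rangle}:\mathfrak{n}\to\mathfrak{n}$ be the Ricci operator of $(N,\langle\cdot,\cdot\rangle)$ at the identity, let $\mathrm{Ric}^{c}_{\langle\cdot,\cdot\rangle}:=\frac12\left(\mathrm{Ric}_{\langle\cdot,\cdot\rangle}-J\,\mathrm{Ric}_{\langle\cdot,\cdot\rangle}J\right)$, and let $\mathrm{sc}(\langle\cdot,\cdot\rangle)=\mathrm{tr}\,\mathrm{Ric}_{\langle\cdot,\cdot\rangle}$ be the scalar curvature. A compatible metric $\langle\cdot,\cdot\rangle$ on $(N,J)$ is called minimal if $$\mathrm{tr}\big(\mathrm{Ric}^{c}_{\langle\cdot,\cdot\rangle}\big)^2=\min\left\{\mathrm{tr}\big(\mathrm{Ric}^{c}_{\langle\cdot,\cdot\rangle'}\big)^2 : \mathrm{sc}(\langle\cdot,\cdot\rangle')=\mathrm{sc}(\langle\cdot,\cdot\rangle)\right\},$$ where $\langle\cdot,\cdot\rangle'$ runs over all compatible left invariant metrics on $(N,J)$. *)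

theory Defs
  imports "HOL-Analysis.Analysis"
begin

text \<open>
  A simply connected nilpotent Lie group is encoded by its Lie algebra, and left invariant
  tensors on it by their values at the identity. The Lie algebra is a bracket \<open>\<mu>\<close> on a type of
  class \<open>euclidean_space\<close>. That class only supplies a finite-dimensional real vector space:
  its built-in inner product is never used as a metric, and the Riemannian metrics below are
  arbitrary inner products \<open>g\<close>.
\<close>

definition lie_bracket :: "('a::real_vector \<Rightarrow> 'a \<Rightarrow> 'a) \<Rightarrow> bool" where
  "lie_bracket \<mu> \<longleftrightarrow> bilinear \<mu> \<and> (\<forall>x. \<mu> x x = 0) \<and>
     (\<forall>x y z. \<mu> x (\<mu> y z) + \<mu> y (\<mu> z x) + \<mu> z (\<mu> x y) = 0)"

fun lower_central :: "('a::real_vector \<Rightarrow> 'a \<Rightarrow> 'a) \<Rightarrow> nat \<Rightarrow> 'a set" where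
  "lower_central \<mu> 0 = UNIV"
| "lower_central \<mu> (Suc k) = span {\<mu> x y | x y. y \<in> lower_central \<mu> k}"

definition nilpotent_lie_bracket :: "('a::real_vector \<Rightarrow> 'a \<Rightarrow> 'a) \<Rightarrow> bool" where
  "nilpotent_lie_bracket \<mu> \<longleftrightarrow> lie_bracket \<mu> \<and> (\<exists>k. lower_central \<mu> k = {0})"

definition complex_structure ::
  "('a::real_vector \<Rightarrow> 'a \<Rightarrow> 'a) \<Rightarrow> ('a \<Rightarrow> 'a) \<Rightarrow> bool" where
  "complex_structure \<mu> J \<longleftrightarrow> linear J \<and> (\<forall>x. J (J x) = - x) \<and>
     (\<forall>x y. \<mu> (J x) (J y) = \<mu> x y + J (\<mu> (J x) y) + J (\<mu> x (J y)))"

definition abelian_complex_structure ::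
  "('a::real_vector \<Rightarrow> 'a \<Rightarrow> 'a) \<Rightarrow> ('a \<Rightarrow> 'a) \<Rightarrow> bool" where
  "abelian_complex_structure \<mu> J \<longleftrightarrow>
     complex_structure \<mu> J \<and> (\<forall>x y. \<mu> (J x) (J y) = \<mu> x y)"

definition holomorphically_isomorphic ::
  "('a::real_vector \<Rightarrow> 'a \<Rightarrow> 'a) \<Rightarrow> ('a \<Rightarrow> 'a) \<Rightarrow>
   ('b::real_vector \<Rightarrow> 'b \<Rightarrow> 'b) \<Rightarrow> ('b \<Rightarrow> 'b) \<Rightarrow> bool" where
  "holomorphically_isomorphic \<mu>\<^sub>1 J\<^sub>1 \<mu>\<^sub>2 J\<^sub>2 \<longleftrightarrow>
     (\<exists>\<alpha>. linear \<alpha> \<and> bij \<alpha> \<and> (\<forall>x y. \<alpha> (\<mu>\<^sub>1 x y) = \<mu>\<^sub>2 (\<alpha> x) (\<alpha> y)) \<and>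
          J\<^sub>2 = \<alpha> \<circ> J\<^sub>1 \<circ> inv \<alpha>)"

definition inner_product :: "('a::real_vector \<Rightarrow> 'a \<Rightarrow> real) \<Rightarrow> bool" where
  "inner_product g \<longleftrightarrow> bilinear g \<and> (\<forall>x y. g x y = g y x) \<and> (\<forall>x. x \<noteq> 0 \<longrightarrow> 0 < g x x)"

definition compatible_metric :: "('a::real_vector \<Rightarrow> 'a) \<Rightarrow> ('a \<Rightarrow> 'a \<Rightarrow> real) \<Rightarrow> bool" where
  "compatible_metric J g \<longleftrightarrow> inner_product g \<and> (\<forall>x y. g (J x) (J y) = g x y)"

text \<open>
  The trace of a linear endomorphism; it does not depend on the basis, so using the standard
  basis of the type is only a choice of coordinates.
\<close>

definition lin_trace :: "('a::euclidean_space \<Rightarrow> 'a) \<Rightarrow> real" where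
  "lin_trace f = (\<Sum>b\<in>Basis. f b \<bullet> b)"

text \<open>
  The Levi-Civita connection on left invariant vector fields: the torsion-free connection
  satisfying \<open>X \<langle>Y, Z\<rangle> = \<langle>\<nabla>\<^bsub>X\<^esub> Y, Z\<rangle> + \<langle>Y, \<nabla>\<^bsub>X\<^esub> Z\<rangle>\<close>, where the left-hand side vanishes because
  \<open>\<langle>Y, Z\<rangle>\<close> is constant. Existence and uniqueness are proved below.
\<close>

definition is_levi_civita ::
  "('a::real_vector \<Rightarrow> 'a \<Rightarrow> 'a) \<Rightarrow> ('a \<Rightarrow> 'a \<Rightarrow> real) \<Rightarrow> ('a \<Rightarrow> 'a \<Rightarrow> 'a) \<Rightarrow> bool" where
  "is_levi_civita \<mu> g D \<longleftrightarrow> bilinear D \<and> (\<forall>x y. D x y - D y x = \<mu> x y) \<and>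
     (\<forall>x y z. g (D x y) z + g y (D x z) = 0)"

definition levi_civita ::
  "('a::real_vector \<Rightarrow> 'a \<Rightarrow> 'a) \<Rightarrow> ('a \<Rightarrow> 'a \<Rightarrow> real) \<Rightarrow> 'a \<Rightarrow> 'a \<Rightarrow> 'a" where
  "levi_civita \<mu> g = (THE D. is_levi_civita \<mu> g D)"

definition curvature ::
  "('a::real_vector \<Rightarrow> 'a \<Rightarrow> 'a) \<Rightarrow> ('a \<Rightarrow> 'a \<Rightarrow> real) \<Rightarrow> 'a \<Rightarrow> 'a \<Rightarrow> 'a \<Rightarrow> 'a" where
  "curvature \<mu> g x y z = (let D = levi_civita \<mu> g in
     D x (D y z) - D y (D x z) - D (\<mu> x y) z)"

definition ricci_tensor ::
  "('a::euclidean_space \<Rightarrow> 'a \<Rightarrow> 'a) \<Rightarrow> ('a \<Rightarrow> 'a \<Rightarrow> real) \<Rightarrow> 'a \<Rightarrow> 'a \<Rightarrow> real" where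
  "ricci_tensor \<mu> g y z = lin_trace (\<lambda>x. curvature \<mu> g x y z)"

definition ricci_operator ::
  "('a::euclidean_space \<Rightarrow> 'a \<Rightarrow> 'a) \<Rightarrow> ('a \<Rightarrow> 'a \<Rightarrow> real) \<Rightarrow> 'a \<Rightarrow> 'a" where
  "ricci_operator \<mu> g x = (THE w. \<forall>y. g w y = ricci_tensor \<mu> g x y)"

definition scalar_curvature ::
  "('a::euclidean_space \<Rightarrow> 'a \<Rightarrow> 'a) \<Rightarrow> ('a \<Rightarrow> 'a \<Rightarrow> real) \<Rightarrow> real" where
  "scalar_curvature \<mu> g = lin_trace (ricci_operator \<mu> g)"

definition ricci_c ::
  "('a::euclidean_space \<Rightarrow> 'a \<Rightarrow> 'a) \<Rightarrow> ('a \<Rightarrow> 'a) \<Rightarrow> ('a \<Rightarrow> 'a \<Rightarrow> real) \<Rightarrow> 'a \<Rightarrow> 'a" where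
  "ricci_c \<mu> J g x = (1/2) *\<^sub>R (ricci_operator \<mu> g x - J (ricci_operator \<mu> g (J x)))"

definition minimal_metric ::
  "('a::euclidean_space \<Rightarrow> 'a \<Rightarrow> 'a) \<Rightarrow> ('a \<Rightarrow> 'a) \<Rightarrow> ('a \<Rightarrow> 'a \<Rightarrow> real) \<Rightarrow> bool" where
  "minimal_metric \<mu> J g \<longleftrightarrow> compatible_metric J g \<and>
     (\<forall>g'. compatible_metric J g' \<and> scalar_curvature \<mu> g' = scalar_curvature \<mu> g \<longrightarrow>
        lin_trace (ricci_c \<mu> J g \<circ> ricci_c \<mu> J g) \<le> lin_trace (ricci_c \<mu> J g' \<circ> ricci_c \<mu> J g'))"

text \<open>
  The exceptional pair on \<open>\<real>\<^sup>6\<close>, with \<open>e\<^sub>i = axis i 1\<close>. The index type \<open>6\<close> consists of the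
  residues modulo 6, so \<open>1, \<dots>, 6\<close> are its six distinct elements (and \<open>6 = 0\<close>).
\<close>

definition mu5 :: "real^6 \<Rightarrow> real^6 \<Rightarrow> real^6" where
  "mu5 x y = (x$1 * y$2 - x$2 * y$1) *\<^sub>R axis 5 1
     + (- (x$1 * y$4 - x$4 * y$1) + (x$2 * y$3 - x$3 * y$2)) *\<^sub>R axis 6 1"

definition J5 :: "real^6 \<Rightarrow> real^6" where
  "J5 x = (x$1) *\<^sub>R axis 2 1 - (x$2) *\<^sub>R axis 1 1
        + (x$3) *\<^sub>R axis 4 1 - (x$4) *\<^sub>R axis 3 1
        + (x$5) *\<^sub>R axis 6 1 - (x$6) *\<^sub>R axis 5 1"

lemma mu5_basis:
  "mu5 (axis 1 1) (axis 2 1) = axis 5 1"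
  "mu5 (axis 1 1) (axis 4 1) = - axis 6 1"
  "mu5 (axis 2 1) (axis 3 1) = axis 6 1"
  "mu5 (axis 1 1) (axis 3 1) = 0"
  "mu5 (axis 2 1) (axis 4 1) = 0"
  "mu5 (axis 3 1) (axis 4 1) = 0"
  "mu5 x (axis 5 1) = 0"
  "mu5 x (axis 6 1) = 0"
  by (simp_all add: mu5_def axis_def)

lemma J5_basis:
  "J5 (axis 1 1) = axis 2 1"
  "J5 (axis 3 1) = axis 4 1"
  "J5 (axis 5 1) = axis 6 1"
  by (simp_all add: J5_def axis_def)

lemma nilpotent_lie_bracket_mu5: "nilpotent_lie_bracket mu5"
proof -
  have bil: "bilinear mu5"
    unfolding bilinear_def mu5_def
    by (auto intro!: linearI simp: algebra_simps)
  have z: "mu5 x (mu5 y z) = 0" for x y z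
    by (simp add: mu5_def axis_def)
  have lie: "lie_bracket mu5"
    unfolding lie_bracket_def using bil by (simp add: z) (simp add: mu5_def)
  have c1: "w \<in> lower_central mu5 1 \<Longrightarrow> mu5 x w = 0" for x w
  proof -
    assume "w \<in> lower_central mu5 1"
    hence w: "w \<in> span {mu5 u v |u v. True}" by simp
    have lin: "linear (mu5 x)" using bil by (simp add: bilinear_def)
    have b: "mu5 x b = 0" if "b \<in> {mu5 u v |u v. True}" for b
      using that z by blast
    show ?thesis by (rule linear_eq_0_on_span[OF lin b w])
  qed
  have sub: "{mu5 x y |x y. y \<in> lower_central mu5 1} \<subseteq> {0}" using c1 by auto
  have "span {mu5 x y |x y. y \<in> lower_central mu5 1} = {0}"
    using span_minimal[OF sub subspace_single_0] span_zero by auto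
  hence "lower_central mu5 (Suc 1) = {0}"
    by (simp only: lower_central.simps(2))
  thus ?thesis unfolding nilpotent_lie_bracket_def using lie by blast
qed

lemma abelian_complex_structure_J5: "abelian_complex_structure mu5 J5"
proof -
  have lin: "linear J5" by (auto intro!: linearI simp: J5_def algebra_simps)
  have u: "i = 1 \<or> i = 2 \<or> i = 3 \<or> i = 4 \<or> i = 5 \<or> i = 6" for i :: 6
  proof (induct i)
    case (of_int z)
    then have "z = 0 \<or> z = 1 \<or> z = 2 \<or> z = 3 \<or> z = 4 \<or> z = 5" by auto
    then show ?case by auto
  qed
  have sq: "J5 (J5 x) = - x" for x
    unfolding vec_eq_iff
  proof
    fix i :: 6
    show "J5 (J5 x) $ i = (- x) $ i"
      using u[of i] by (elim disjE) (simp_all add: J5_def axis_def)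
  qed
  have ab: "mu5 (J5 x) (J5 y) = mu5 x y" for x y
    by (simp add: J5_def mu5_def axis_def algebra_simps)
  have anti: "mu5 (J5 x) y = - mu5 x (J5 y)" for x y
    using ab[of x "J5 y"] nilpotent_lie_bracket_mu5
    by (simp add: sq nilpotent_lie_bracket_def lie_bracket_def bilinear_rneg)
      (metis minus_minus)
  show ?thesis
    unfolding abelian_complex_structure_def complex_structure_def
    using nilpotent_lie_bracket_mu5
    by (auto simp: lin sq ab anti linear_neg[OF lin] nilpotent_lie_bracket_def lie_bracket_def
        bilinear_rneg)
qed

lemma inner_product_riesz:
  fixes g :: "'a::euclidean_space \<Rightarrow> 'a \<Rightarrow> real"
  assumes "inner_product g" "linear \<phi>"
  shows "\<exists>!w. \<forall>y. g w y = \<phi> y"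
proof -
  have bil: "bilinear g" and pos: "\<And>x. x \<noteq> 0 \<Longrightarrow> 0 < g x x"
    using assms(1) by (auto simp: inner_product_def)
  have lr: "linear (g w)" and ll: "linear (\<lambda>w. g w y)" for w y
    using bil by (auto simp: bilinear_def)
  define F where "F w = (\<Sum>b\<in>Basis. g w b *\<^sub>R b)" for w :: 'a
  have Fb: "F w \<bullet> b = g w b" if "b \<in> Basis" for w b
    using that by (simp add: F_def)
  have lin: "linear F"
    by (rule linearI; rule euclidean_eqI)
      (simp_all add: Fb inner_add_left linear_add[OF ll] linear_cmul[OF ll])
  have ext: "\<forall>y. g w y = \<psi> y" if "\<And>b. b \<in> Basis \<Longrightarrow> g w b = \<psi> b" "linear \<psi>" for w \<psi>
    using linear_eq_on_span[OF lr[of w] that(2) that(1)] by (simp add: span_Basis)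
  have "inj F"
    unfolding linear_injective_0[OF lin]
  proof (intro allI impI)
    fix w assume "F w = 0"
    hence "\<forall>y. g w y = (\<lambda>_. 0) y" by (intro ext) (auto simp: Fb[symmetric] linear_zero)
    thus "w = 0" using pos[of w] by force
  qed
  hence "surj F" using linear_injective_imp_surjective[OF lin] by simp
  then obtain w where "F w = (\<Sum>b\<in>Basis. \<phi> b *\<^sub>R b)" by (metis surjD)
  hence "\<And>b. b \<in> Basis \<Longrightarrow> g w b = \<phi> b" by (simp add: Fb[symmetric])
  hence w: "\<forall>y. g w y = \<phi> y" using ext assms(2) by blast
  show ?thesis
  proof (rule ex1I[of _ w])
    show "\<forall>y. g w y = \<phi> y" by fact
    fix v assume "\<forall>y. g v y = \<phi> y"
    hence "g (v - w) (v - w) = 0" using w by (simp add: linear_diff[OF ll])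
    thus "v = w" using pos[of "v - w"] by force
  qed
qed

lemma levi_civita_koszul:
  assumes "lie_bracket \<mu>" "inner_product g" "is_levi_civita \<mu> g D"
  shows "2 * g (D x y) z = g (\<mu> x y) z - g (\<mu> y z) x + g (\<mu> z x) y"
proof -
  have bil: "bilinear g" and s: "\<And>x y. g x y = g y x"
    using assms(2) by (auto simp: inner_product_def)
  have d: "g (u - v) w = g u w - g v w" for u v w
    by (rule bilinear_lsub[OF bil])
  have t: "\<mu> x y = D x y - D y x" and m: "g (D x y) z = - g (D x z) y" for x y z
    using assms(3) s unfolding is_levi_civita_def by (simp, metis add_eq_0_iff)
  show ?thesis unfolding t d using m[of x y z] m[of y z x] m[of z x y] by linarith
qed

lemma levi_civita_ex1:
  fixes g :: "'a::euclidean_space \<Rightarrow> 'a \<Rightarrow> real"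
  assumes "lie_bracket \<mu>" "inner_product g"
  shows "\<exists>!D. is_levi_civita \<mu> g D"
proof -
  have bg: "bilinear g" and s: "\<And>x y. g x y = g y x"
    using assms(2) by (auto simp: inner_product_def)
  have bm: "bilinear \<mu>" and alt: "\<And>x. \<mu> x x = 0"
    using assms(1) by (auto simp: lie_bracket_def)
  note bl = bilinear_ladd[OF bg] bilinear_radd[OF bg] bilinear_lmul[OF bg] bilinear_rmul[OF bg]
    bilinear_ladd[OF bm] bilinear_radd[OF bm] bilinear_lmul[OF bm] bilinear_rmul[OF bm]
    bilinear_lsub[OF bg] bilinear_lneg[OF bg]
  have anti: "\<mu> y x = - \<mu> x y" for x y
  proof -
    have "\<mu> x y + \<mu> y x = 0"
      using alt[of "x + y"] alt[of x] alt[of y]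
      by (simp add: bilinear_ladd[OF bm] bilinear_radd[OF bm] add.commute)
    thus ?thesis by (rule minus_unique[symmetric])
  qed
  define K where "K x y z = (g (\<mu> x y) z - g (\<mu> y z) x + g (\<mu> z x) y) / 2" for x y z
  have "linear (K x y)" for x y
    by (rule linearI) (simp_all add: K_def bl algebra_simps add_divide_distrib diff_divide_distrib)
  hence R: "\<exists>!w. \<forall>z. g w z = K x y z" for x y
    by (rule inner_product_riesz[OF assms(2)])
  have eqI: "u = v" if "\<And>z. g u z = g v z" for u v
  proof -
    have "g (u - v) (u - v) = 0" using that by (simp add: bl)
    thus ?thesis using assms(2) unfolding inner_product_def
      by (metis less_irrefl right_minus_eq)
  qed
  from R have "\<forall>x y. \<exists>w. \<forall>z. g w z = K x y z" by blast
  then obtain D where D: "\<And>x y z. g (D x y) z = K x y z" by metis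
  have "is_levi_civita \<mu> g D"
    unfolding is_levi_civita_def bilinear_def
  proof (intro conjI allI)
    show "linear (D x)" for x
      by (rule linearI; rule eqI) (simp_all add: bl D K_def algebra_simps add_divide_distrib diff_divide_distrib)
    show "linear (\<lambda>x. D x y)" for y
      by (rule linearI; rule eqI) (simp_all add: bl D K_def algebra_simps add_divide_distrib diff_divide_distrib)
    show "D x y - D y x = \<mu> x y" for x y
    proof (rule eqI)
      fix z
      show "g (D x y - D y x) z = g (\<mu> x y) z"
        using anti[of y x] anti[of z x] anti[of z y]
        by (simp add: bl D K_def, argo)
    qed
    show "g (D x y) z + g y (D x z) = 0" for x y z
      using anti[of y x] anti[of z x] anti[of z y]
      by (simp add: s[of y "D x z"] D K_def bl, argo)
  qed
  moreover have "D1 = D2" if "is_levi_civita \<mu> g D1" "is_levi_civita \<mu> g D2" for D1 D2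
  proof (intro ext eqI)
    fix x y z
    show "g (D1 x y) z = g (D2 x y) z"
      using levi_civita_koszul[OF assms that(1), of x y z]
        levi_civita_koszul[OF assms that(2), of x y z] by linarith
  qed
  ultimately show ?thesis by blast
qed

lemma is_levi_civita_levi_civita:
  fixes g :: "'a::euclidean_space \<Rightarrow> 'a \<Rightarrow> real"
  assumes "lie_bracket \<mu>" "inner_product g"
  shows "is_levi_civita \<mu> g (levi_civita \<mu> g)"
  unfolding levi_civita_def by (rule theI'[OF levi_civita_ex1[OF assms]])

lemma ricci_operator:
  fixes g :: "'a::euclidean_space \<Rightarrow> 'a \<Rightarrow> real"
  assumes "lie_bracket \<mu>" "inner_product g"
  shows "g (ricci_operator \<mu> g x) y = ricci_tensor \<mu> g x y"
proof -
  have b: "bilinear (levi_civita \<mu> g)"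
    using is_levi_civita_levi_civita[OF assms] by (simp add: is_levi_civita_def)
  have "linear (ricci_tensor \<mu> g x)"
    by (rule linearI)
      (simp_all add: ricci_tensor_def lin_trace_def curvature_def Let_def
        bilinear_radd[OF b] bilinear_rmul[OF b] inner_add_left inner_diff_left
        sum.distrib sum_subtractf sum_distrib_left right_diff_distrib)
  from theI'[OF inner_product_riesz[OF assms(2) this]]
  show ?thesis unfolding ricci_operator_def by blast
qed

end

theory Submission
  imports Defs
begin

text \<open>
  Nilpotency provides a complex flag of ideals, hence a complex basis in which the bracket depends on
  five complex numbers \<open>\<alpha>, \<gamma>, a, b, c\<close> only, and Gram--Schmidt makes that basis unitary for any given
  compatible metric. With \<open>X = |\<alpha>|\<^sup>2\<close>, \<open>G = |\<gamma>|\<^sup>2\<close>, \<open>B = |a|\<^sup>2 + |b|\<^sup>2\<close>, \<open>C = |c|\<^sup>2\<close> one finds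
  \<open>- 2 sc = X + G + 2 B + C\<close>, and \<open>8 tr (Ric\<^sup>c)\<^sup>2\<close> is
  \<open>4 (X + G + B)\<^sup>2 + (X - 2 B - 2 C)\<^sup>2 + (G + 2 B + C)\<^sup>2\<close> plus nonnegative off-diagonal terms.
  So the quotient of \<open>tr (Ric\<^sup>c)\<^sup>2\<close> by \<open>sc\<^sup>2\<close> is at least \<open>7/6\<close> in the 3-step case (\<open>c = 0\<close>) and at
  least \<open>3/2\<close> in the 2-step case (\<open>\<alpha> = 0\<close>), while it is constantly \<open>5/2\<close> if \<open>\<alpha> = a = b = c = 0 \<noteq> \<gamma>\<close>.
  These bounds are attained after a suitable change of basis. The 2-step case concerns a complex
  \<open>2 \<times> 2\<close> matrix up to *-congruence and scaling, and the only congruence class in which the bound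
  \<open>3/2\<close> is approached but not attained is that of the exceptional pair.
\<close>

section \<open>The Ricci tensor in an orthonormal frame\<close>

lemma linear_inv:
  assumes "linear T" "bij T"
  shows "linear (inv T)"
proof -
  have inv: "inv T (T x) = x" "T (inv T y) = y" for x y
    using assms(2) by (simp_all add: bij_is_inj bij_is_surj surj_f_inv_f)
  have "inv T (u + v) = inv T u + inv T v" "inv T (r *\<^sub>R u) = r *\<^sub>R inv T u" for u v r
    using inv(1)[of "inv T u + inv T v"] inv(1)[of "r *\<^sub>R inv T u"]
    by (simp_all add: linear_add[OF assms(1)] linear_cmul[OF assms(1)] inv(2))
  thus ?thesis by (intro linearI)
qed

text \<open>Cyclicity of the trace: \<open>f = T \<circ> \<rho> \<circ> S\<close> with
  \<open>S = inv T\<close>. Expanding in the two standard bases and exchanging the sums turns the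
  trace of \<open>T \<circ> \<rho> \<circ> S\<close> into that of
  \<open>S \<circ> T \<circ> \<rho>\<close>. Traces are moved in this way from the abstract space to
  a model.\<close>

lemma lin_trace_conj:
  fixes T :: "'b::euclidean_space \<Rightarrow> 'a::euclidean_space"
  assumes T: "linear T" "bij T" and \<rho>: "linear \<rho>" and conj: "\<And>x. f (T x) = T (\<rho> x)"
  shows "lin_trace f = lin_trace \<rho>"
proof -
  define S where "S = inv T"
  have S: "linear S" and ST: "S (T x) = x" and TS: "T (S y) = y" for x y
    unfolding S_def using T by (simp_all add: bij_is_inj bij_is_surj surj_f_inv_f linear_inv)
  have f: "f x = T (\<rho> (S x))" for x using conj[of "S x"] by (simp add: TS)
  have expand: "h x = (\<Sum>d\<in>Basis. (x \<bullet> d) *\<^sub>R h d)"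
    if "linear h" for h :: "'c::euclidean_space \<Rightarrow> 'd::real_vector" and x
  proof -
    have "h x = h (\<Sum>d\<in>Basis. (x \<bullet> d) *\<^sub>R d)" by (simp add: euclidean_representation)
    also have "\<dots> = (\<Sum>d\<in>Basis. (x \<bullet> d) *\<^sub>R h d)"
      by (simp only: linear_sum[OF that] linear_cmul[OF that])
    finally show ?thesis .
  qed
  have "lin_trace f = (\<Sum>b\<in>Basis. \<Sum>d\<in>Basis. (S b \<bullet> d) * (T (\<rho> d) \<bullet> b))"
    unfolding lin_trace_def f expand[OF linear_compose[OF \<rho> T(1), unfolded o_def], of "S _"]
    by (simp add: inner_sum_left)
  also have "\<dots> = (\<Sum>d\<in>Basis. \<Sum>b\<in>Basis. (T (\<rho> d) \<bullet> b) * (S b \<bullet> d))"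
    by (subst sum.swap) (simp add: mult.commute)
  also have "\<dots> = (\<Sum>d\<in>Basis. S (T (\<rho> d)) \<bullet> d)"
    unfolding expand[OF S, of "T (\<rho> _)"] by (simp add: inner_sum_left)
  finally show ?thesis by (simp add: ST lin_trace_def)
qed

text \<open>Since \<open>T\<close> is an isometry, the summand equals
  \<open>inv T (f (T b)) \<bullet> b\<close>, a diagonal entry of the conjugated map.\<close>

lemma lin_trace_conj_isometry:
  fixes T :: "'b::euclidean_space \<Rightarrow> 'a::euclidean_space"
  assumes T: "linear T" "bij T" and f: "linear f"
    and g: "bilinear g" "\<And>x y. g (T x) (T y) = x \<bullet> y"
  shows "lin_trace f = (\<Sum>b\<in>Basis. g (f (T b)) (T b))"
proof -
  have S: "linear (inv T)" and TS: "T (inv T y) = y" for y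
    using T by (simp_all add: bij_is_surj surj_f_inv_f linear_inv)
  have "lin_trace f = lin_trace (inv T \<circ> f \<circ> T)"
    using linear_compose[OF linear_compose[OF T(1) f] S]
    by (intro lin_trace_conj[OF T]) (simp_all add: TS o_assoc)
  also have "\<dots> = (\<Sum>b\<in>Basis. g (f (T b)) (T b))"
    using g(2)[of "inv T (f (T _))"] by (simp add: lin_trace_def TS)
  finally show ?thesis .
qed

lemma lie_bracket_anticommute:
  assumes "lie_bracket \<mu>"
  shows "\<mu> x y = - \<mu> y x"
proof -
  have bm: "bilinear \<mu>" and alt: "\<mu> z z = 0" for z using assms by (auto simp: lie_bracket_def)
  have "\<mu> x y + \<mu> y x = 0"
    using alt[of "x + y"] alt[of x] alt[of y]
    by (simp add: bilinear_ladd[OF bm] bilinear_radd[OF bm] add.commute)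
  thus ?thesis by (simp add: eq_neg_iff_add_eq_0)
qed

text \<open>
  The last two assumptions say that the Lie algebra is unimodular and that its Killing form vanishes;
  both hold when it is nilpotent.
\<close>

lemma ricci_tensor_orthonormal:
  fixes T :: "'b::euclidean_space \<Rightarrow> 'a::euclidean_space"
  assumes lie: "lie_bracket \<mu>" and ip: "inner_product g"
    and T: "linear T" "bij T" and iso: "\<And>x y. g (T x) (T y) = x \<bullet> y"
    and \<nu>: "\<And>x y. \<mu> (T x) (T y) = T (\<nu> x y)"
    and unimodular: "\<And>x. (\<Sum>b\<in>Basis. \<nu> x b \<bullet> b) = 0"
    and killing: "\<And>x y. (\<Sum>b\<in>Basis. \<nu> x (\<nu> y b) \<bullet> b) = 0"
  shows "ricci_tensor \<mu> g (T y) (T z) =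
    (\<Sum>b\<in>Basis. \<Sum>d\<in>Basis. (\<nu> b d \<bullet> y) * (\<nu> b d \<bullet> z)) / 4 - (\<Sum>b\<in>Basis. \<nu> y b \<bullet> \<nu> z b) / 2"
proof -
  define D where "D = levi_civita \<mu> g"
  have lc: "is_levi_civita \<mu> g D"
    unfolding D_def by (rule is_levi_civita_levi_civita[OF lie ip])
  have bD: "bilinear D" and skew: "g (D x y) z = - g y (D x z)" for x y z
    using lc unfolding is_levi_civita_def by (auto simp: eq_neg_iff_add_eq_0)
  have bg: "bilinear g" and sym: "g x y = g y x" for x y
    using ip by (auto simp: inner_product_def)
  have bm: "bilinear \<mu>" and alt: "\<mu> x x = 0" for x using lie by (auto simp: lie_bracket_def)
  have inj: "T x = T y \<longleftrightarrow> x = y" for x y using T(2) by (simp add: bij_is_inj inj_eq)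
  have surj: "\<exists>x. v = T x" for v using T(2) by (meson bij_is_surj surjD)
  have anti: "\<mu> x y = - \<mu> y x" for x y
    by (rule lie_bracket_anticommute[OF lie])
  have nanti: "\<nu> x y = - \<nu> y x" for x y
    using anti[of "T x" "T y"] by (simp add: \<nu> inj flip: linear_neg[OF T(1)])
  have nself: "\<nu> x x = 0" for x
    using alt[of "T x"] linear_0[OF T(1)] by (metis \<nu> inj)
  have nlin: "linear (\<nu> x)" for x
    by (rule linearI)
      (simp_all add: inj[symmetric] \<nu>[symmetric] linear_add[OF T(1)] linear_cmul[OF T(1)]
        bilinear_radd[OF bm] bilinear_rmul[OF bm])
  have kos: "g (D (T x) (T y)) (T z) = (\<nu> x y \<bullet> z - \<nu> y z \<bullet> x + \<nu> z x \<bullet> y) / 2" for x y z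
    using levi_civita_koszul[OF lie ip lc, of "T x" "T y" "T z"] by (simp add: \<nu> iso)
  have Tsum: "T x = (\<Sum>d\<in>Basis. (x \<bullet> d) *\<^sub>R T d)" for x
  proof -
    have "T x = T (\<Sum>d\<in>Basis. (x \<bullet> d) *\<^sub>R d)" by (simp add: euclidean_representation)
    thus ?thesis by (simp add: linear_sum[OF T(1)] linear_cmul[OF T(1)])
  qed
  have parseval: "g p q = (\<Sum>l\<in>Basis. g p (T l) * g q (T l))" for p q
  proof -
    obtain x y where "p = T x" "q = T y" using surj by meson
    thus ?thesis by (simp add: iso euclidean_inner[of x y])
  qed
  define P where "P i l = \<nu> y i \<bullet> l" for i l
  define R where "R i l = \<nu> z i \<bullet> l" for i l
  define N where "N i l = \<nu> i l \<bullet> y" for i l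
  define M where "M i l = \<nu> i l \<bullet> z" for i l
  have NM: "N l i = - N i l" "M l i = - M i l" for i l
    unfolding N_def M_def by (subst nanti, simp)+
  \<comment> \<open>\<open>f\<close> collects what Koszul's formula gives for the traced curvature,
    \<open>h\<close> is the shape aimed at. They agree only after symmetrization in \<open>i\<close>
    and \<open>l\<close>, where \<open>N\<close> and \<open>M\<close> are skew.\<close>
  define f where "f i l = (- R i l - R l i - M i l) * (P i l - N i l - P l i) / 4
    + P i l * (- R l i - R i l + M i l) / 2" for i l
  define h where "h i l = M i l * N i l / 4 - P i l * R i l / 2 - P i l * R l i / 2" for i l
  have lin: "linear (\<lambda>x. curvature \<mu> g x (T y) (T z))"
    unfolding curvature_def Let_def D_def[symmetric]
    by (rule linearI; simp only: bilinear_ladd[OF bD] bilinear_radd[OF bD] bilinear_lmul[OF bD]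
        bilinear_rmul[OF bD] bilinear_ladd[OF bm] bilinear_lmul[OF bm])
      (simp_all add: algebra_simps)
  \<comment> \<open>The sum of the vectors \<open>D (T i) (T i)\<close> is dual to the linear form
    "trace of ad", which vanishes by \<open>unimodular\<close>.\<close>
  have t1: "(\<Sum>i\<in>Basis. g (D (T y) (T z)) (D (T i) (T i))) = 0"
  proof -
    obtain v where v: "D (T y) (T z) = T v" using surj by meson
    have "g (T v) (D (T i) (T i)) = \<nu> v i \<bullet> i" for i
      using kos[of i i v] nanti[of i v] by (subst sym) (simp add: nself)
    thus ?thesis using unimodular[of v] by (simp add: v)
  qed
  have t2: "g (D (T i) (T z)) (D (T y) (T i)) =
      (\<Sum>l\<in>Basis. (- R i l - R l i - M i l) * (P i l - N i l - P l i) / 4)" for i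
  proof -
    have "g (D (T i) (T z)) (T l) * g (D (T y) (T i)) (T l) =
        (- R i l - R l i - M i l) * (P i l - N i l - P l i) / 4" for l
      by (simp add: kos nanti[of i z] nanti[of l i] nanti[of l y] P_def R_def N_def M_def)
    thus ?thesis by (subst parseval) (rule sum.cong[OF refl])
  qed
  have t3: "g (D (\<mu> (T i) (T y)) (T z)) (T i) = - (\<Sum>l\<in>Basis. P i l * (- R l i - R i l + M i l) / 2)"
    for i
  proof -
    have e: "\<nu> l z = - \<nu> z l" "\<nu> i y = - \<nu> y i" for l
      by (rule nanti)+
    have lg: "linear (\<lambda>v. g (D v (T z)) (T i))"
      by (rule linearI) (simp_all add: bilinear_ladd[OF bD] bilinear_ladd[OF bg]
          bilinear_lmul[OF bD] bilinear_lmul[OF bg])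
    have "g (D (T (\<nu> i y)) (T z)) (T i) = (\<Sum>l\<in>Basis. (\<nu> i y \<bullet> l) * g (D (T l) (T z)) (T i))"
      by (subst Tsum) (simp add: linear_sum[OF lg] linear_cmul[OF lg])
    also have "\<dots> = (\<Sum>l\<in>Basis. - (P i l * (- R l i - R i l + M i l) / 2))"
      by (intro sum.cong refl) (simp add: kos e P_def R_def N_def M_def)
    finally show ?thesis by (simp add: \<nu> sum_negf)
  qed
  have "ricci_tensor \<mu> g (T y) (T z) = (\<Sum>i\<in>Basis. g (curvature \<mu> g (T i) (T y) (T z)) (T i))"
    unfolding ricci_tensor_def by (rule lin_trace_conj_isometry[OF T lin bg iso])
  also have "\<dots> = (\<Sum>i\<in>Basis. - g (D (T y) (T z)) (D (T i) (T i)) + g (D (T i) (T z)) (D (T y) (T i))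
      - g (D (\<mu> (T i) (T y)) (T z)) (T i))"
    by (intro sum.cong refl) (simp add: curvature_def Let_def bilinear_lsub[OF bg] skew flip: D_def)
  also have "\<dots> = (\<Sum>i\<in>Basis. \<Sum>l\<in>Basis. f i l)"
    by (simp add: sum.distrib sum_subtractf sum_negf t1 t2 t3 f_def)
  also have "\<dots> = (\<Sum>i\<in>Basis. \<Sum>l\<in>Basis. (f i l + f l i) / 2)"
    using sum.swap[of f Basis Basis] by (simp add: sum.distrib flip: sum_divide_distrib)
  also have "\<dots> = (\<Sum>i\<in>Basis. \<Sum>l\<in>Basis. (h i l + h l i) / 2)"
  proof (intro sum.cong refl)
    fix i l
    show "(f i l + f l i) / 2 = (h i l + h l i) / 2"
      unfolding f_def h_def NM(1)[of l i] NM(2)[of l i] by (simp add: field_simps)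
  qed
  also have "\<dots> = (\<Sum>i\<in>Basis. \<Sum>l\<in>Basis. h i l)"
    using sum.swap[of h Basis Basis] by (simp add: sum.distrib flip: sum_divide_distrib)
  also have "\<dots> = (\<Sum>b\<in>Basis. \<Sum>d\<in>Basis. N b d * M b d) / 4
      - (\<Sum>b\<in>Basis. \<Sum>d\<in>Basis. P b d * R b d) / 2 - (\<Sum>b\<in>Basis. \<Sum>d\<in>Basis. P b d * R d b) / 2"
    by (simp add: h_def sum_subtractf mult.commute flip: sum_divide_distrib)
  also have "(\<Sum>b\<in>Basis. \<Sum>d\<in>Basis. P b d * R b d) = (\<Sum>b\<in>Basis. \<nu> y b \<bullet> \<nu> z b)"
    unfolding P_def R_def by (intro sum.cong refl) (rule euclidean_inner[symmetric])
  \<comment> \<open>This mixed sum is the trace of ad z composed with ad y, so it is removed by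
    \<open>killing\<close>.\<close>
  also have "(\<Sum>b\<in>Basis. \<Sum>d\<in>Basis. P b d * R d b) = (\<Sum>b\<in>Basis. \<nu> z (\<nu> y b) \<bullet> b)"
  proof (intro sum.cong refl)
    fix b :: 'b
    have "\<nu> z (\<nu> y b) = \<nu> z (\<Sum>d\<in>Basis. (\<nu> y b \<bullet> d) *\<^sub>R d)" by (simp add: euclidean_representation)
    also have "\<dots> = (\<Sum>d\<in>Basis. (\<nu> y b \<bullet> d) *\<^sub>R \<nu> z d)"
      by (simp only: linear_sum[OF nlin] linear_cmul[OF nlin])
    finally show "(\<Sum>d\<in>Basis. P b d * R d b) = \<nu> z (\<nu> y b) \<bullet> b"
      by (simp add: P_def R_def inner_sum_left)
  qed
  finally show ?thesis by (simp add: killing N_def M_def)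
qed

section \<open>Brackets on complex three-space\<close>

type_synonym cvec = "complex \<times> complex \<times> complex"

definition times_i :: "cvec \<Rightarrow> cvec" where
  "times_i x = (\<i> * fst x, \<i> * fst (snd x), \<i> * snd (snd x))"

text \<open>
  Every bracket satisfying \<open>\<mu>(i x, i y) = \<mu>(x, y)\<close> with a complex flag of ideals has this form: for
  the standard complex basis \<open>f\<^sub>1, f\<^sub>2, f\<^sub>3\<close>, it is determined by \<open>\<mu>(f\<^sub>1, i f\<^sub>1) = \<alpha> f\<^sub>2 + \<gamma> f\<^sub>3\<close>,
  \<open>\<mu>(f\<^sub>1, f\<^sub>2) = a f\<^sub>3\<close>, \<open>\<mu>(f\<^sub>1, i f\<^sub>2) = b f\<^sub>3\<close> and \<open>\<mu>(f\<^sub>2, i f\<^sub>2) = c f\<^sub>3\<close>. The Jacobi identity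
  amounts to \<open>\<alpha> = 0 \<or> c = 0\<close>; it is not part of the definition.
\<close>

definition cbracket ::
    "complex \<Rightarrow> complex \<Rightarrow> complex \<Rightarrow> complex \<Rightarrow> complex \<Rightarrow> cvec \<Rightarrow> cvec \<Rightarrow> cvec" where
  "cbracket \<alpha> \<gamma> a b c x y =
     (let w = cnj (fst x) * fst (snd y) - cnj (fst y) * fst (snd x);
          s = Im (cnj (fst x) * fst y); t = Im (cnj (fst (snd x)) * fst (snd y))
      in (0, s *\<^sub>R \<alpha>, s *\<^sub>R \<gamma> + Re w *\<^sub>R a + Im w *\<^sub>R b + t *\<^sub>R c))"

section \<open>Ricci form of the model brackets in the standard metric\<close>

lemma sum_Basis_cvec:
  "(\<Sum>b\<in>(Basis :: cvec set). f b) =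
    f (1, 0, 0) + f (\<i>, 0, 0) + (f (0, 1, 0) + f (0, \<i>, 0) + (f (0, 0, 1) + f (0, 0, \<i>)))"
proof -
  have prod: "(\<Sum>b\<in>Basis. h b) = (\<Sum>b\<in>Basis. h (b, 0)) + (\<Sum>b\<in>Basis. h (0, b))"
    for h :: "'c::euclidean_space \<times> 'd::euclidean_space \<Rightarrow> 'a"
    unfolding Basis_prod_def by (subst sum.union_disjoint) (auto simp: sum.reindex inj_on_def)
  show ?thesis
    by (simp add: prod Basis_complex_def zero_prod_def add.assoc)
qed

lemma inner_cvec: "(x :: cvec) \<bullet> y = Re (fst x) * Re (fst y) + Im (fst x) * Im (fst y) +
    (Re (fst (snd x)) * Re (fst (snd y)) + Im (fst (snd x)) * Im (fst (snd y)) +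
    (Re (snd (snd x)) * Re (snd (snd y)) + Im (snd (snd x)) * Im (snd (snd y))))"
  by (cases x; cases y) (simp add: inner_complex_def)

text \<open>Bracketing with a fixed vector moves the flag strictly down, so it is a strictly
  triangular map and has trace zero. The same holds for the composite of two such maps in
  \<open>cbracket_killing\<close>.\<close>

lemma cbracket_unimodular: "(\<Sum>e\<in>Basis. cbracket \<alpha> \<gamma> a b c x e \<bullet> e) = 0"
  by (simp add: sum_Basis_cvec inner_cvec cbracket_def Let_def)

lemma cbracket_killing:
  "(\<Sum>e\<in>Basis. cbracket \<alpha> \<gamma> a b c x (cbracket \<alpha> \<gamma> a b c y e) \<bullet> e) = 0"
  by (simp add: sum_Basis_cvec inner_cvec cbracket_def Let_def)

text \<open>The right-hand side of \<open>ricci_tensor_orthonormal\<close> for a model bracket,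
  hence the Ricci tensor in any unitary frame with these parameters.\<close>

definition cricci ::
    "complex \<Rightarrow> complex \<Rightarrow> complex \<Rightarrow> complex \<Rightarrow> complex \<Rightarrow> cvec \<Rightarrow> cvec \<Rightarrow> real" where
  "cricci \<alpha> \<gamma> a b c x y = (\<Sum>e\<in>Basis. \<Sum>d\<in>Basis.
      (cbracket \<alpha> \<gamma> a b c e d \<bullet> x) * (cbracket \<alpha> \<gamma> a b c e d \<bullet> y)) / 4
    - (\<Sum>e\<in>Basis. cbracket \<alpha> \<gamma> a b c x e \<bullet> cbracket \<alpha> \<gamma> a b c y e) / 2"

text \<open>Each unordered pair of basis vectors contributes minus half the squared length of its
  bracket. The parameters \<open>a\<close> and \<open>b\<close> occur twice, since the bracket of
  \<open>\<i> x\<close> and \<open>\<i> y\<close> is that of \<open>x\<close> and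
  \<open>y\<close>.\<close>

lemma sum_cricci:
  "(\<Sum>e\<in>Basis. cricci \<alpha> \<gamma> a b c e e) =
    - ((norm \<alpha>)\<^sup>2 + (norm \<gamma>)\<^sup>2 + 2 * ((norm a)\<^sup>2 + (norm b)\<^sup>2) + (norm c)\<^sup>2) / 2"
  unfolding cmod_power2 cricci_def sum_Basis_cvec
  by (simp add: inner_cvec cbracket_def Let_def power2_eq_square field_simps)

text \<open>The Hermitian matrix of the complex linear part of the Ricci operator. It is
  tridiagonal: \<open>r\<close> couples the first two coordinates, \<open>q\<close> the last
  two.\<close>

definition cricci_c ::
    "complex \<Rightarrow> complex \<Rightarrow> complex \<Rightarrow> complex \<Rightarrow> complex \<Rightarrow> cvec \<Rightarrow> cvec" where
  "cricci_c \<alpha> \<gamma> a b c x =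
    (let X = (norm \<alpha>)\<^sup>2; G = (norm \<gamma>)\<^sup>2; B = (norm a)\<^sup>2 + (norm b)\<^sup>2; C = (norm c)\<^sup>2;
         r = - Complex ((\<gamma> + c) \<bullet> b) ((\<gamma> + c) \<bullet> a) / 2; q = \<alpha> * cnj \<gamma> / 4
     in (- ((X + G + B) / 2) *\<^sub>R fst x + r * fst (snd x),
         cnj r * fst x + ((X - 2 * B - 2 * C) / 4) *\<^sub>R fst (snd x) + q * snd (snd x),
         cnj q * fst (snd x) + ((G + 2 * B + C) / 4) *\<^sub>R snd (snd x)))"

text \<open>The operator \<open>1/2 (Ric - J Ric J)\<close> corresponds to the average of the Ricci
  form over the complex structure. This is what identifies the explicit matrix, entry by
  entry.\<close>

lemma cricci_c:
  assumes "y \<in> Basis"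
  shows "cricci_c \<alpha> \<gamma> a b c x \<bullet> y =
    (cricci \<alpha> \<gamma> a b c x y + cricci \<alpha> \<gamma> a b c (times_i x) (times_i y)) / 2"
proof -
  have "y \<in> {(1, 0, 0), (\<i>, 0, 0), (0, 1, 0), (0, \<i>, 0), (0, 0, 1), (0, 0, \<i>)}"
    using assms by (auto simp: Basis_prod_def Basis_complex_def zero_prod_def)
  thus ?thesis
    unfolding cricci_def sum_Basis_cvec cricci_c_def Let_def cmod_power2
    by (elim insertE emptyE; hypsubst;
        simp add: inner_cvec cbracket_def times_i_def Let_def inner_complex_def power2_eq_square;
        simp add: field_simps)
qed

text \<open>A holomorphic isomorphism from the model bracket with the given parameters, thought of
  as a choice of complex basis.\<close>

definition cframe ::
    "('a::real_vector \<Rightarrow> 'a \<Rightarrow> 'a) \<Rightarrow> ('a \<Rightarrow> 'a) \<Rightarrow>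
     complex \<Rightarrow> complex \<Rightarrow> complex \<Rightarrow> complex \<Rightarrow> complex \<Rightarrow> (cvec \<Rightarrow> 'a) \<Rightarrow> bool" where
  "cframe \<mu> J \<alpha> \<gamma> a b c T \<longleftrightarrow> linear T \<and> bij T \<and> (\<forall>x. T (times_i x) = J (T x)) \<and>
     (\<forall>x y. \<mu> (T x) (T y) = T (cbracket \<alpha> \<gamma> a b c x y))"

lemma linear_cricci_c: "linear (cricci_c \<alpha> \<gamma> a b c)"
proof -
  have "linear (\<lambda>x :: cvec. (d1 *\<^sub>R fst x + r * fst (snd x),
      r' * fst x + d2 *\<^sub>R fst (snd x) + q * snd (snd x),
      q' * fst (snd x) + d3 *\<^sub>R snd (snd x)))" for d1 d2 d3 :: real and r r' q q' :: complex
    by (rule linearI) (simp_all add: algebra_simps)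
  thus ?thesis unfolding cricci_c_def[abs_def] Let_def .
qed

text \<open>The real trace of the square of a Hermitian matrix is twice the sum of the squared
  moduli of its entries.\<close>

lemma lin_trace_cricci_c:
  fixes \<alpha> \<gamma> a b c
  defines "X \<equiv> (norm \<alpha>)\<^sup>2" and "G \<equiv> (norm \<gamma>)\<^sup>2" and "B \<equiv> (norm a)\<^sup>2 + (norm b)\<^sup>2" and "C \<equiv> (norm c)\<^sup>2"
  shows "8 * lin_trace (cricci_c \<alpha> \<gamma> a b c \<circ> cricci_c \<alpha> \<gamma> a b c) =
    4 * (X + G + B)\<^sup>2 + (X - 2 * B - 2 * C)\<^sup>2 + (G + 2 * B + C)\<^sup>2
      + 8 * (((\<gamma> + c) \<bullet> a)\<^sup>2 + ((\<gamma> + c) \<bullet> b)\<^sup>2) + 2 * X * G"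
proof -
  define r where "r = - Complex ((\<gamma> + c) \<bullet> b) ((\<gamma> + c) \<bullet> a) / 2"
  define q where "q = \<alpha> * cnj \<gamma> / 4"
  define d1 where "d1 = - ((X + G + B) / 2)"
  define d2 where "d2 = (X - 2 * B - 2 * C) / 4"
  define d3 where "d3 = (G + 2 * B + C) / 4"
  have R: "cricci_c \<alpha> \<gamma> a b c x =
      (d1 *\<^sub>R fst x + r * fst (snd x),
       cnj r * fst x + d2 *\<^sub>R fst (snd x) + q * snd (snd x),
       cnj q * fst (snd x) + d3 *\<^sub>R snd (snd x))" for x
    by (simp add: cricci_c_def r_def q_def d1_def d2_def d3_def X_def G_def B_def C_def Let_def)
  have "lin_trace (cricci_c \<alpha> \<gamma> a b c \<circ> cricci_c \<alpha> \<gamma> a b c) =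
      2 * (d1\<^sup>2 + d2\<^sup>2 + d3\<^sup>2 + 2 * (norm r)\<^sup>2 + 2 * (norm q)\<^sup>2)"
    unfolding lin_trace_def sum_Basis_cvec cmod_power2
    by (simp add: R inner_cvec power2_eq_square algebra_simps)
  moreover have "4 * (norm r)\<^sup>2 = ((\<gamma> + c) \<bullet> a)\<^sup>2 + ((\<gamma> + c) \<bullet> b)\<^sup>2"
    by (simp add: r_def norm_divide power_divide cmod_power2)
  moreover have "16 * (norm q)\<^sup>2 = X * G"
    by (simp add: q_def X_def G_def norm_divide norm_mult power_divide power_mult_distrib)
  ultimately show ?thesis
    by (simp add: d1_def d2_def d3_def power_divide)
qed

lemma times_i_inner: "times_i x \<bullet> y = - (x \<bullet> times_i y)"
  by (simp add: inner_cvec times_i_def)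

lemma
  fixes \<mu> :: "'a::euclidean_space \<Rightarrow> 'a \<Rightarrow> 'a"
  assumes lie: "lie_bracket \<mu>" and ip: "inner_product g" and J: "linear J"
    and frame: "cframe \<mu> J \<alpha> \<gamma> a b c T" and iso: "\<And>x y. g (T x) (T y) = x \<bullet> y"
  shows scalar_curvature_cframe: "scalar_curvature \<mu> g =
      - ((norm \<alpha>)\<^sup>2 + (norm \<gamma>)\<^sup>2 + 2 * ((norm a)\<^sup>2 + (norm b)\<^sup>2) + (norm c)\<^sup>2) / 2"
    and lin_trace_ricci_c_cframe: "lin_trace (ricci_c \<mu> J g \<circ> ricci_c \<mu> J g) =
      lin_trace (cricci_c \<alpha> \<gamma> a b c \<circ> cricci_c \<alpha> \<gamma> a b c)"
proof -
  have T: "linear T" "bij T" and TJ: "T (times_i x) = J (T x)"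
    and br: "\<mu> (T x) (T y) = T (cbracket \<alpha> \<gamma> a b c x y)" for x y
    using frame unfolding cframe_def by blast+
  let ?Q = "cricci \<alpha> \<gamma> a b c"
  define \<rho> where "\<rho> x = inv T (ricci_operator \<mu> g (T x))" for x
  have \<rho>: "ricci_operator \<mu> g (T x) = T (\<rho> x)" for x
    by (simp add: \<rho>_def T(2) bij_is_surj surj_f_inv_f)
  have \<rho>Q: "\<rho> x \<bullet> y = ?Q x y" for x y
    using ricci_operator[OF lie ip, of "T x" "T y"]
      ricci_tensor_orthonormal[OF lie ip T iso br cbracket_unimodular cbracket_killing, of x y]
    by (simp add: \<rho> iso cricci_def)
  have \<rho>sym: "\<rho> x \<bullet> y = \<rho> y \<bullet> x" for x y
    unfolding \<rho>Q cricci_def by (simp add: mult.commute inner_commute)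
  \<comment> \<open>Linearity follows from the symmetry of the Ricci form:
    \<open>\<rho> x \<bullet> y\<close> equals \<open>\<rho> y \<bullet> x\<close>, which is linear
    in \<open>x\<close>.\<close>
  have "linear \<rho>"
    by (rule linearI; rule euclidean_eqI)
      (metis \<rho>sym inner_add_left inner_add_right, metis \<rho>sym inner_scaleR_left inner_scaleR_right)
  show "scalar_curvature \<mu> g =
      - ((norm \<alpha>)\<^sup>2 + (norm \<gamma>)\<^sup>2 + 2 * ((norm a)\<^sup>2 + (norm b)\<^sup>2) + (norm c)\<^sup>2) / 2"
    unfolding scalar_curvature_def lin_trace_conj[OF T \<open>linear \<rho>\<close>, of "ricci_operator \<mu> g", OF \<rho>]
    unfolding lin_trace_def \<rho>Q by (rule sum_cricci)
  have "ricci_c \<mu> J g (T x) = T (cricci_c \<alpha> \<gamma> a b c x)" for x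
  proof -
    have "(1/2) *\<^sub>R (\<rho> x - times_i (\<rho> (times_i x))) = cricci_c \<alpha> \<gamma> a b c x"
      by (rule euclidean_eqI) (simp add: inner_diff_left times_i_inner \<rho>Q cricci_c)
    thus ?thesis
      by (simp add: ricci_c_def \<rho> flip: TJ linear_diff[OF T(1)] linear_cmul[OF T(1)])
  qed
  thus "lin_trace (ricci_c \<mu> J g \<circ> ricci_c \<mu> J g) =
      lin_trace (cricci_c \<alpha> \<gamma> a b c \<circ> cricci_c \<alpha> \<gamma> a b c)"
    by (intro lin_trace_conj[OF T] linear_compose linear_cricci_c) simp
qed

section \<open>Adapted frames\<close>

text \<open>The complex linear map sending the standard complex basis to \<open>f1\<close>,
  \<open>f2\<close>, \<open>f3\<close>, with multiplication by \<open>\<i>\<close> on the target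
  played by \<open>J\<close>.\<close>

definition cmap :: "('a \<Rightarrow> 'a) \<Rightarrow> 'a \<Rightarrow> 'a \<Rightarrow> 'a \<Rightarrow> cvec \<Rightarrow> 'a::real_vector" where
  "cmap J f1 f2 f3 x = Re (fst x) *\<^sub>R f1 + Im (fst x) *\<^sub>R J f1
    + Re (fst (snd x)) *\<^sub>R f2 + Im (fst (snd x)) *\<^sub>R J f2
    + Re (snd (snd x)) *\<^sub>R f3 + Im (snd (snd x)) *\<^sub>R J f3"

lemma linear_cmap: "linear (cmap J f1 f2 f3)"
  by (rule linearI) (simp_all add: cmap_def algebra_simps)

lemma cmap_times_i:
  assumes "linear J" "\<And>x. J (J x) = - x"
  shows "cmap J f1 f2 f3 (times_i x) = J (cmap J f1 f2 f3 x)"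
  by (simp add: cmap_def times_i_def assms(2) linear_add[OF assms(1)] linear_cmul[OF assms(1)]
      algebra_simps)

text \<open>An abelian \<open>J\<close> satisfies \<open>\<mu> (J x) y = - \<mu> x (J y)\<close>, so
  with \<open>f3\<close> central the four listed brackets determine all others. Injectivity makes
  the three vectors a complex basis because the real dimension is 6.\<close>

lemma cframeI:
  fixes \<mu> :: "'a::euclidean_space \<Rightarrow> 'a \<Rightarrow> 'a"
  assumes lie: "lie_bracket \<mu>" and J: "abelian_complex_structure \<mu> J" and dim: "DIM('a) = 6"
    and inj: "\<And>x. cmap J f1 f2 f3 x = 0 \<Longrightarrow> x = 0"
    and br: "\<mu> f1 (J f1) = cmap J f1 f2 f3 (0, \<alpha>, \<gamma>)"
      "\<mu> f1 f2 = cmap J f1 f2 f3 (0, 0, a)" "\<mu> f1 (J f2) = cmap J f1 f2 f3 (0, 0, b)"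
      "\<mu> f2 (J f2) = cmap J f1 f2 f3 (0, 0, c)"
    and central: "\<And>x. \<mu> x f3 = 0"
  shows "cframe \<mu> J \<alpha> \<gamma> a b c (cmap J f1 f2 f3)"
proof -
  have bm: "bilinear \<mu>" and alt: "\<mu> x x = 0" for x using lie by (auto simp: lie_bracket_def)
  have lJ: "linear J" and JJ: "J (J x) = - x" and ab: "\<mu> (J x) (J y) = \<mu> x y" for x y
    using J by (auto simp: abelian_complex_structure_def complex_structure_def)
  have anti: "\<mu> x y = - \<mu> y x" for x y
    by (rule lie_bracket_anticommute[OF lie])
  have JR: "\<mu> (J x) y = - \<mu> x (J y)" for x y
    using ab[of x "J y"] by (simp add: JJ bilinear_rneg[OF bm]) (metis minus_minus)
  have z: "\<mu> x f3 = 0" "\<mu> x (J f3) = 0" "\<mu> f3 x = 0" "\<mu> (J f3) x = 0" for x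
    using central[of x] JR[of x f3] central[of "J x"] anti[of f3 x] anti[of "J f3" x] by simp_all
  have r: "\<mu> f2 f1 = - \<mu> f1 f2" "\<mu> (J f1) f1 = - \<mu> f1 (J f1)" "\<mu> (J f2) f1 = - \<mu> f1 (J f2)"
    "\<mu> f2 (J f1) = \<mu> f1 (J f2)" "\<mu> (J f1) f2 = - \<mu> f1 (J f2)" "\<mu> (J f2) f2 = - \<mu> f2 (J f2)"
    using anti[of f2 f1] anti[of f2 "J f1"] anti[of "J f2" f1] by (simp_all add: JR)
  have "inj (cmap J f1 f2 f3)"
    using inj linear_injective_0[OF linear_cmap] by blast
  moreover from this have "surj (cmap J f1 f2 f3)"
  proof -
    have "dim (range (cmap J f1 f2 f3)) = DIM(cvec)"
      using dim_image_eq[OF linear_cmap[of J f1 f2 f3], of UNIV] \<open>inj _\<close> by (simp add: dim_UNIV)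
    hence "dim (range (cmap J f1 f2 f3)) = DIM('a)" by (simp add: dim)
    hence "span (range (cmap J f1 f2 f3)) = UNIV" by (simp add: dim_eq_full)
    thus ?thesis
      using linear_subspace_image[OF linear_cmap[of J f1 f2 f3] subspace_UNIV]
      by (simp add: span_eq_iff[THEN iffD2])
  qed
  ultimately have "bij (cmap J f1 f2 f3)" by (simp add: bij_def)
  moreover have "\<mu> (cmap J f1 f2 f3 x) (cmap J f1 f2 f3 y) = cmap J f1 f2 f3 (cbracket \<alpha> \<gamma> a b c x y)"
    for x y
  proof -
    have "\<mu> (cmap J f1 f2 f3 x) (cmap J f1 f2 f3 y) =
        Im (cnj (fst x) * fst y) *\<^sub>R \<mu> f1 (J f1) +
        Re (cnj (fst x) * fst (snd y) - cnj (fst y) * fst (snd x)) *\<^sub>R \<mu> f1 f2 +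
        Im (cnj (fst x) * fst (snd y) - cnj (fst y) * fst (snd x)) *\<^sub>R \<mu> f1 (J f2) +
        Im (cnj (fst (snd x)) * fst (snd y)) *\<^sub>R \<mu> f2 (J f2)"
      unfolding cmap_def
      by (simp add: bilinear_ladd[OF bm] bilinear_radd[OF bm] bilinear_lmul[OF bm]
          bilinear_rmul[OF bm] z r alt ab algebra_simps)
    also have "\<dots> = cmap J f1 f2 f3 (cbracket \<alpha> \<gamma> a b c x y)"
      unfolding br by (simp add: cbracket_def Let_def cmap_def algebra_simps)
    finally show ?thesis .
  qed
  ultimately show ?thesis
    unfolding cframe_def using linear_cmap cmap_times_i[OF lJ JJ] by blast
qed

text \<open>Applies \<open>cframeI\<close> to the images of \<open>F1\<close>, \<open>F2\<close>,
  \<open>F3\<close>, so that a change of basis can be computed entirely in the model.\<close>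

lemma cframe_change:
  fixes \<mu> :: "'a::euclidean_space \<Rightarrow> 'a \<Rightarrow> 'a"
  assumes lie: "lie_bracket \<mu>" and J: "abelian_complex_structure \<mu> J" and dim: "DIM('a) = 6"
    and frame: "cframe \<mu> J \<alpha> \<gamma> a b c T"
    and inj: "\<And>x. cmap times_i F1 F2 F3 x = 0 \<Longrightarrow> x = 0"
    and br: "cbracket \<alpha> \<gamma> a b c F1 (times_i F1) = cmap times_i F1 F2 F3 (0, \<alpha>', \<gamma>')"
      "cbracket \<alpha> \<gamma> a b c F1 F2 = cmap times_i F1 F2 F3 (0, 0, a')"
      "cbracket \<alpha> \<gamma> a b c F1 (times_i F2) = cmap times_i F1 F2 F3 (0, 0, b')"
      "cbracket \<alpha> \<gamma> a b c F2 (times_i F2) = cmap times_i F1 F2 F3 (0, 0, c')"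
    and central: "\<And>x. cbracket \<alpha> \<gamma> a b c x F3 = 0"
  shows "cframe \<mu> J \<alpha>' \<gamma>' a' b' c' (T \<circ> cmap times_i F1 F2 F3)"
proof -
  have T: "linear T" "bij T" and TJ: "T (times_i x) = J (T x)"
    and brT: "\<mu> (T x) (T y) = T (cbracket \<alpha> \<gamma> a b c x y)" for x y
    using frame unfolding cframe_def by blast+
  have e: "cmap J (T F1) (T F2) (T F3) x = T (cmap times_i F1 F2 F3 x)" for x
    by (simp add: cmap_def linear_add[OF T(1)] linear_cmul[OF T(1)] flip: TJ)
  have "cframe \<mu> J \<alpha>' \<gamma>' a' b' c' (cmap J (T F1) (T F2) (T F3))"
  proof (rule cframeI[OF lie J dim])
    show "x = 0" if "cmap J (T F1) (T F2) (T F3) x = 0" for x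
      using that inj T unfolding e by (metis bij_is_inj inj_eq linear_0)
    show "\<mu> x (T F3) = 0" for x
      using brT[of "inv T x" F3] central T
      by (simp add: bij_is_surj surj_f_inv_f linear_0)
  qed (simp_all only: e brT br flip: TJ)
  moreover have "cmap J (T F1) (T F2) (T F3) = T \<circ> cmap times_i F1 F2 F3"
    using e by auto
  ultimately show ?thesis by simp
qed

lemma cmap_times_i_apply:
  "cmap times_i F1 F2 F3 x =
    (fst x * fst F1 + fst (snd x) * fst F2 + snd (snd x) * fst F3,
     fst x * fst (snd F1) + fst (snd x) * fst (snd F2) + snd (snd x) * fst (snd F3),
     fst x * snd (snd F1) + fst (snd x) * snd (snd F2) + snd (snd x) * snd (snd F3))"
  by (simp add: cmap_def times_i_def prod_eq_iff complex_eq_iff)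

text \<open>How basis changes that respect the flag act on the five parameters. The term with
  \<open>n\<close> appears because the old second vector has to be re-expanded in the new second and
  third ones.\<close>

lemma cframe_triangular:
  fixes \<mu> :: "'a::euclidean_space \<Rightarrow> 'a \<Rightarrow> 'a" and k1 :: real and k2 k3 l m n :: complex
  assumes lie: "lie_bracket \<mu>" and J: "abelian_complex_structure \<mu> J" and dim: "DIM('a) = 6"
    and frame: "cframe \<mu> J \<alpha> \<gamma> a b c T"
    and k: "k1 \<noteq> 0" "k2 \<noteq> 0" "k3 \<noteq> 0"
  defines "\<alpha>' \<equiv> of_real (k1\<^sup>2) * \<alpha> / k2"
  shows "cframe \<mu> J \<alpha>'
     ((k1\<^sup>2 *\<^sub>R \<gamma> - (2 * k1 * Im l) *\<^sub>R a + (2 * k1 * Re l) *\<^sub>R b + (norm l)\<^sup>2 *\<^sub>R c - \<alpha>' * n) / k3)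
     ((k1 *\<^sub>R (Re k2 *\<^sub>R a + Im k2 *\<^sub>R b) + Im (cnj l * k2) *\<^sub>R c) / k3)
     ((k1 *\<^sub>R (Re k2 *\<^sub>R b - Im k2 *\<^sub>R a) + Re (cnj l * k2) *\<^sub>R c) / k3)
     ((norm k2)\<^sup>2 *\<^sub>R c / k3)
     (T \<circ> cmap times_i (of_real k1, l, m) (0, k2, n) (0, 0, k3))"
proof (rule cframe_change[OF lie J dim frame])
  show "x = 0" if "cmap times_i (of_real k1, l, m) (0, k2, n) (0, 0, k3) x = 0" for x
    using that k by (auto simp: cmap_times_i_apply prod_eq_iff)
  have e: "z / k2 * k2 = z" "z / k3 * k3 = z" for z using k by simp_all
  note [simp] = cbracket_def Let_def times_i_def zero_prod_def
  let ?F1 = "(of_real k1, l, m)" and ?F2 = "(0, k2, n)" and ?F3 = "(0, 0, k3) :: cvec"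
  show "cbracket \<alpha> \<gamma> a b c ?F1 (times_i ?F1) = cmap times_i ?F1 ?F2 ?F3 (0, \<alpha>',
     (k1\<^sup>2 *\<^sub>R \<gamma> - (2 * k1 * Im l) *\<^sub>R a + (2 * k1 * Re l) *\<^sub>R b + (norm l)\<^sup>2 *\<^sub>R c - \<alpha>' * n) / k3)"
    unfolding cmap_times_i_apply fst_conv snd_conv e cmod_power2 unfolding \<alpha>'_def e
    by (simp add: complex_eq_iff) (simp add: power2_eq_square algebra_simps)
  show "cbracket \<alpha> \<gamma> a b c ?F1 ?F2 = cmap times_i ?F1 ?F2 ?F3 (0, 0,
     (k1 *\<^sub>R (Re k2 *\<^sub>R a + Im k2 *\<^sub>R b) + Im (cnj l * k2) *\<^sub>R c) / k3)"
    unfolding cmap_times_i_apply fst_conv snd_conv e by (simp add: complex_eq_iff algebra_simps)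
  show "cbracket \<alpha> \<gamma> a b c ?F1 (times_i ?F2) = cmap times_i ?F1 ?F2 ?F3 (0, 0,
     (k1 *\<^sub>R (Re k2 *\<^sub>R b - Im k2 *\<^sub>R a) + Re (cnj l * k2) *\<^sub>R c) / k3)"
    unfolding cmap_times_i_apply fst_conv snd_conv e by (simp add: complex_eq_iff algebra_simps)
  show "cbracket \<alpha> \<gamma> a b c ?F2 (times_i ?F2) = cmap times_i ?F1 ?F2 ?F3 (0, 0, (norm k2)\<^sup>2 *\<^sub>R c / k3)"
    unfolding cmap_times_i_apply fst_conv snd_conv e cmod_power2
    by (simp add: complex_eq_iff power2_eq_square algebra_simps)
  show "cbracket \<alpha> \<gamma> a b c x ?F3 = 0" for x by simp
qed

section \<open>Existence of a frame from nilpotency\<close>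

text \<open>Take \<open>y\<close> in the last member of the lower central series not contained in
  \<open>W\<close>. Its brackets lie in the next member, which is contained in
  \<open>W\<close>.\<close>

lemma nilpotent_absorbing_vector:
  assumes nil: "nilpotent_lie_bracket \<mu>" and W: "subspace W" "W \<noteq> UNIV"
  obtains y where "y \<notin> W" "\<And>x. \<mu> x y \<in> W"
proof -
  obtain K where "lower_central \<mu> K = {0}" using nil by (auto simp: nilpotent_lie_bracket_def)
  hence "lower_central \<mu> K \<subseteq> W" using subspace_0[OF W(1)] by simp
  then obtain k where k: "lower_central \<mu> k \<subseteq> W" "\<And>j. j < k \<Longrightarrow> \<not> lower_central \<mu> j \<subseteq> W"
    using exists_least_iff[of "\<lambda>k. lower_central \<mu> k \<subseteq> W"] by auto
  then obtain j where j: "k = Suc j" using W(2) by (cases k) auto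
  then obtain y where y: "y \<in> lower_central \<mu> j" "y \<notin> W" using k(2)[of j] by auto
  have "\<mu> x y \<in> lower_central \<mu> k" for x
    using y(1) by (auto simp: j intro: span_base)
  thus ?thesis using that y(2) k(1) by blast
qed

text \<open>Absorbing vectors for zero, for the complex line \<open>V1\<close> of \<open>f3\<close>
  and for the complex plane \<open>V2 f2\<close> of \<open>f2\<close> and \<open>f3\<close> build
  the flag from the bottom. As \<open>J\<close> can be moved across the bracket, brackets with
  \<open>J f2\<close> and \<open>J f1\<close> stay in the same subspaces.\<close>

lemma nilpotent_cframe:
  fixes \<mu> :: "'a::euclidean_space \<Rightarrow> 'a \<Rightarrow> 'a"
  assumes nil: "nilpotent_lie_bracket \<mu>" and J: "abelian_complex_structure \<mu> J" and dim: "DIM('a) = 6"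
  obtains \<alpha> \<gamma> a b c T where "cframe \<mu> J \<alpha> \<gamma> a b c T" "\<alpha> = 0 \<or> c = 0"
proof -
  have lie: "lie_bracket \<mu>" using nil by (simp add: nilpotent_lie_bracket_def)
  have bm: "bilinear \<mu>"
    and jac: "\<mu> x (\<mu> y z) + \<mu> y (\<mu> z x) + \<mu> z (\<mu> x y) = 0" for x y z
    using lie unfolding lie_bracket_def by blast+
  have lJ: "linear J" and JJ: "J (J x) = - x" and ab: "\<mu> (J x) (J y) = \<mu> x y" for x y
    using J by (auto simp: abelian_complex_structure_def complex_structure_def)
  have JR: "\<mu> x (J y) = - \<mu> (J x) y" for x y
    using ab[of x "J y"] by (simp add: JJ bilinear_rneg[OF bm])
  have J0: "J 0 = 0" by (rule linear_0[OF lJ])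
  \<comment> \<open>\<open>y \<notin> W\<close> and \<open>u y \<in> W\<close> with \<open>W\<close> a complex subspace force the complex number \<open>u\<close> to vanish.\<close>
  have indep: "u = 0" if "subspace V" "\<And>v. v \<in> V \<Longrightarrow> J v \<in> V" "y \<notin> V"
    "Re u *\<^sub>R y + Im u *\<^sub>R J y \<in> V" for u y V
  proof (rule ccontr)
    assume "u \<noteq> 0"
    define r where "r = (Re u)\<^sup>2 + (Im u)\<^sup>2"
    have r: "r \<noteq> 0" using \<open>u \<noteq> 0\<close> by (simp add: r_def complex_eq_iff)
    let ?v = "Re u *\<^sub>R y + Im u *\<^sub>R J y"
    have "Re u *\<^sub>R ?v - Im u *\<^sub>R J ?v \<in> V"
      using that by (intro subspace_diff subspace_scale) auto
    also have "Re u *\<^sub>R ?v - Im u *\<^sub>R J ?v = r *\<^sub>R y"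
      by (simp add: r_def linear_add[OF lJ] linear_cmul[OF lJ] JJ algebra_simps power2_eq_square)
    finally have "(1 / r) *\<^sub>R r *\<^sub>R y \<in> V" by (rule subspace_scale[OF that(1)])
    with r that(3) show False by simp
  qed
  have "(UNIV :: 'a set) \<noteq> {0}" using nonempty_Basis nonzero_Basis by blast
  from nilpotent_absorbing_vector[OF nil subspace_single_0 this[symmetric]]
  obtain f3 where f3: "f3 \<noteq> 0" "\<And>x. \<mu> x f3 = 0" by auto
  define V1 where "V1 = range (\<lambda>w. Re w *\<^sub>R f3 + Im w *\<^sub>R J f3)"
  define V2 where "V2 f2 = range (\<lambda>(v, w). Re v *\<^sub>R f2 + Im v *\<^sub>R J f2 + (Re w *\<^sub>R f3 + Im w *\<^sub>R J f3))" for f2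
  have lc1: "linear (\<lambda>w. Re w *\<^sub>R f3 + Im w *\<^sub>R J f3)"
    by (rule linearI) (simp_all add: algebra_simps)
  have lc2: "linear (\<lambda>(v, w). Re v *\<^sub>R f2 + Im v *\<^sub>R J f2 + (Re w *\<^sub>R f3 + Im w *\<^sub>R J f3))" for f2
    by (rule linearI) (auto simp: algebra_simps)
  have sV1: "subspace V1" and sV2: "subspace (V2 f2)" for f2
    unfolding V1_def V2_def using linear_subspace_image[OF lc1] linear_subspace_image[OF lc2] by simp_all
  have JV1: "J v \<in> V1" if "v \<in> V1" for v
  proof -
    from that obtain w where "v = Re w *\<^sub>R f3 + Im w *\<^sub>R J f3" by (auto simp: V1_def)
    hence "J v = Re (\<i> * w) *\<^sub>R f3 + Im (\<i> * w) *\<^sub>R J f3"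
      by (simp add: linear_add[OF lJ] linear_cmul[OF lJ] JJ)
    thus ?thesis unfolding V1_def by blast
  qed
  have JV2: "J x \<in> V2 f2" if "x \<in> V2 f2" for x f2
  proof -
    from that obtain v w where "x = Re v *\<^sub>R f2 + Im v *\<^sub>R J f2 + (Re w *\<^sub>R f3 + Im w *\<^sub>R J f3)"
      by (auto simp: V2_def)
    hence "J x = (\<lambda>(v, w). Re v *\<^sub>R f2 + Im v *\<^sub>R J f2 + (Re w *\<^sub>R f3 + Im w *\<^sub>R J f3)) (\<i> * v, \<i> * w)"
      by (simp add: linear_add[OF lJ] linear_cmul[OF lJ] JJ)
    thus ?thesis unfolding V2_def by blast
  qed
  have proper: "range h \<noteq> (UNIV :: 'a set)" if "linear h" "DIM('b) < 6"
    for h :: "'b::euclidean_space \<Rightarrow> 'a"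
  proof
    assume "range h = UNIV"
    hence "DIM('a) \<le> DIM('b)"
      using dim_image_le[OF that(1), of UNIV] by (simp add: dim_UNIV)
    thus False using dim that(2) by simp
  qed
  have "V1 \<noteq> UNIV" unfolding V1_def by (rule proper[OF lc1]) simp
  from nilpotent_absorbing_vector[OF nil sV1 this]
  obtain f2 where f2: "f2 \<notin> V1" "\<And>x. \<mu> x f2 \<in> V1" by auto
  have "V2 f2 \<noteq> UNIV" unfolding V2_def by (rule proper[OF lc2]) simp
  from nilpotent_absorbing_vector[OF nil sV2 this]
  obtain f1 where f1: "f1 \<notin> V2 f2" "\<And>x. \<mu> x f1 \<in> V2 f2" by auto
  have mJ: "\<mu> x (J f2) \<in> V1" "\<mu> x (J f1) \<in> V2 f2" for x
    unfolding JR using f1 f2 sV1 sV2 by (auto intro: subspace_neg)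
  obtain \<alpha> \<gamma> where "\<mu> f1 (J f1) = Re \<alpha> *\<^sub>R f2 + Im \<alpha> *\<^sub>R J f2 + (Re \<gamma> *\<^sub>R f3 + Im \<gamma> *\<^sub>R J f3)"
    using mJ(2)[of f1] by (auto simp: V2_def)
  moreover obtain a where "\<mu> f1 f2 = Re a *\<^sub>R f3 + Im a *\<^sub>R J f3"
    using f2(2)[of f1] by (auto simp: V1_def)
  moreover obtain b where "\<mu> f1 (J f2) = Re b *\<^sub>R f3 + Im b *\<^sub>R J f3"
    using mJ(1)[of f1] by (auto simp: V1_def)
  moreover obtain c where "\<mu> f2 (J f2) = Re c *\<^sub>R f3 + Im c *\<^sub>R J f3"
    using mJ(1)[of f2] by (auto simp: V1_def)
  ultimately have br: "\<mu> f1 (J f1) = cmap J f1 f2 f3 (0, \<alpha>, \<gamma>)"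
    "\<mu> f1 f2 = cmap J f1 f2 f3 (0, 0, a)" "\<mu> f1 (J f2) = cmap J f1 f2 f3 (0, 0, b)"
    "\<mu> f2 (J f2) = cmap J f1 f2 f3 (0, 0, c)"
    by (simp_all add: cmap_def)
  have inj: "x = 0" if "cmap J f1 f2 f3 x = 0" for x
  proof -
    obtain u v w where x: "x = (u, v, w)" by (cases x) auto
    let ?c = "\<lambda>u y. Re u *\<^sub>R y + Im u *\<^sub>R J y"
    have s: "?c u f1 + (?c v f2 + ?c w f3) = 0" using that by (simp add: cmap_def x add.assoc)
    have "?c v f2 + ?c w f3 = (\<lambda>(v, w). ?c v f2 + ?c w f3) (v, w)" by simp
    hence "?c v f2 + ?c w f3 \<in> V2 f2" unfolding V2_def by blast
    moreover have "?c u f1 = - (?c v f2 + ?c w f3)" using s by (simp only: eq_neg_iff_add_eq_0)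
    ultimately have "?c u f1 \<in> V2 f2" using subspace_neg[OF sV2] by metis
    hence u: "u = 0" using indep[OF sV2 JV2 f1(1)] by blast
    have "?c w f3 \<in> V1" unfolding V1_def by blast
    moreover have "?c v f2 = - ?c w f3"
      using s unfolding u by (simp only: eq_neg_iff_add_eq_0) simp
    ultimately have "?c v f2 \<in> V1" using subspace_neg[OF sV1] by metis
    hence v: "v = 0" using indep[OF sV1 JV1 f2(1)] by blast
    have "?c w f3 \<in> {0}" using s u v by simp
    hence "w = 0" using indep[OF subspace_single_0, of f3 w] f3(1) J0 by auto
    thus ?thesis using u v by (simp add: x zero_prod_def)
  qed
  have frame: "cframe \<mu> J \<alpha> \<gamma> a b c (cmap J f1 f2 f3)"
    by (rule cframeI[OF lie J dim inj br f3(2)])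
  have "\<alpha> = 0 \<or> c = 0"
  proof -
    let ?T = "cmap J f1 f2 f3" let ?m = "cbracket \<alpha> \<gamma> a b c"
    have T: "linear ?T" "bij ?T" and m: "\<mu> (?T x) (?T y) = ?T (?m x y)" for x y
      using frame unfolding cframe_def by blast+
    have "?T (?m x (?m y z) + ?m y (?m z x) + ?m z (?m x y)) = ?T 0" for x y z
      using jac[of "?T x" "?T y" "?T z"] by (simp add: m linear_add[OF T(1)] linear_0[OF T(1)])
    hence mj: "?m x (?m y z) + ?m y (?m z x) + ?m z (?m x y) = 0" for x y z
      using T(2) by (metis bij_is_inj inj_eq)
    show ?thesis
      \<comment> \<open>In both instances only the term containing the bracket of the first two
        vectors survives. It is a multiple of \<open>c\<close> by \<open>Re \<alpha>\<close> or
        \<open>Im \<alpha>\<close>, up to sign.\<close>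
      using mj[of "(1,0,0)" "(\<i>,0,0)" "(0,\<i>,0)"] mj[of "(1,0,0)" "(\<i>,0,0)" "(0,1,0)"]
      by (auto simp: cbracket_def Let_def zero_prod_def complex_eq_iff)
  qed
  with frame show ?thesis by (rule that)
qed

section \<open>Compatible metrics and unitary frames\<close>

lemma compatible_metric_cframe:
  fixes \<mu> :: "'a::euclidean_space \<Rightarrow> 'a \<Rightarrow> 'a"
  assumes "cframe \<mu> J \<alpha> \<gamma> a b c T"
  obtains g where "compatible_metric J g" "\<And>x y. g (T x) (T y) = x \<bullet> y"
proof
  have T: "linear T" "bij T" and TJ: "T (times_i x) = J (T x)" for x
    using assms unfolding cframe_def by blast+
  have S: "linear (inv T)" and ST: "inv T (T x) = x" and TS: "T (inv T y) = y" for x y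
    using T by (simp_all add: linear_inv bij_is_inj bij_is_surj surj_f_inv_f)
  define g where "g x y = inv T x \<bullet> inv T y" for x y
  show "g (T x) (T y) = x \<bullet> y" for x y by (simp add: g_def ST)
  have "bilinear g"
    unfolding bilinear_def g_def
    by (auto intro!: linearI simp: linear_add[OF S] linear_cmul[OF S] inner_add_left inner_add_right)
  moreover have "inv T x \<noteq> 0" if "x \<noteq> 0" for x
    using that TS[of x] linear_0[OF T(1)] by metis
  moreover have "inv T (J x) = times_i (inv T x)" for x
    using TJ[of "inv T x"] ST by (metis TS)
  moreover have "times_i u \<bullet> times_i v = u \<bullet> v" for u v
    by (simp add: inner_cvec times_i_def algebra_simps)
  ultimately show "compatible_metric J g"
    by (auto simp: compatible_metric_def inner_product_def g_def inner_commute)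
qed

text \<open>Hermitian Gram-Schmidt started at the bottom of the flag, so that the change of basis is
  triangular and the bracket keeps its shape.\<close>

lemma gram_schmidt_cframe:
  fixes \<mu> :: "'a::euclidean_space \<Rightarrow> 'a \<Rightarrow> 'a"
  assumes frame: "cframe \<mu> J \<alpha> \<gamma> a b c T" and g: "compatible_metric J g"
  obtains k1 k2 k3 :: real and l m n where "0 < k1" "0 < k2" "0 < k3"
    "\<And>x y. g ((T \<circ> cmap times_i (of_real k1, l, m) (0, of_real k2, n) (0, 0, of_real k3)) x)
        ((T \<circ> cmap times_i (of_real k1, l, m) (0, of_real k2, n) (0, 0, of_real k3)) y) = x \<bullet> y"
proof -
  have T: "linear T" "bij T" and TJ: "T (times_i x) = J (T x)" for x
    using frame unfolding cframe_def by blast+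
  define h where "h x y = g (T x) (T y)" for x y
  have bg: "bilinear g" and gsym: "g x y = g y x" and gpos: "x \<noteq> 0 \<Longrightarrow> 0 < g x x"
    and gJ: "g (J x) (J y) = g x y" for x y
    using g by (auto simp: compatible_metric_def inner_product_def)
  have bh: "bilinear h"
    unfolding bilinear_def h_def
    by (intro conjI allI linearI; simp only: linear_add[OF T(1)] linear_cmul[OF T(1)]
        bilinear_ladd[OF bg] bilinear_radd[OF bg] bilinear_lmul[OF bg] bilinear_rmul[OF bg])
  have hsym: "h x y = h y x" for x y using gsym by (simp add: h_def)
  have hpos: "0 < h x x" if "x \<noteq> 0" for x
  proof -
    have "T x \<noteq> 0" using that T linear_0[OF T(1)] by (metis bij_is_inj inj_eq)
    thus ?thesis using gpos by (simp add: h_def)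
  qed
  have hi: "h (times_i x) (times_i y) = h x y" for x y by (simp add: h_def TJ gJ)
  have ii: "times_i (times_i x) = - x" for x by (simp add: times_i_def prod_eq_iff flip: mult.assoc)
  have hL: "h (times_i x) y = - h x (times_i y)" for x y
    using hi[of x "times_i y"] by (simp add: ii bilinear_rneg[OF bh])
  have hxi: "h x (times_i x) = 0" for x using hL[of x x] hsym[of x "times_i x"] by simp
  note bil = bilinear_ladd[OF bh] bilinear_radd[OF bh] bilinear_lmul[OF bh] bilinear_rmul[OF bh]
    bilinear_lsub[OF bh] bilinear_rsub[OF bh]
  \<comment> \<open>For a unit vector \<open>u\<close> this is the Hermitian projection onto the
    complex line of \<open>u\<close>, since \<open>u\<close> and \<open>times_i u\<close> are then
    orthonormal for \<open>h\<close>.\<close>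
  define pr where "pr u y = h y u *\<^sub>R u + h y (times_i u) *\<^sub>R times_i u" for u y
  define nm where "nm y = (1 / sqrt (h y y)) *\<^sub>R y" for y
  have nm: "h (nm y) (nm y) = 1" if "y \<noteq> 0" for y
    using hpos[OF that] by (simp add: nm_def bil flip: power2_eq_square)
  have prh: "h (y - pr u y) u = 0" "h (y - pr u y) (times_i u) = 0" if "h u u = 1" for u y
    using that by (simp_all add: pr_def bil hL hxi ii bilinear_rneg[OF bh])
  have prz: "h (pr u y) v = 0" "h (pr u y) (times_i v) = 0" if "h u v = 0" "h u (times_i v) = 0" for u v y
    using that by (simp_all add: pr_def bil hL ii bilinear_rneg[OF bh])
  have nmz: "h (nm y) v = 0" if "h y v = 0" for y v using that by (simp add: nm_def bil)
  define F3 where "F3 = nm (0, 0, 1)"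
  define y2 where "y2 = (0, 1, 0) - pr F3 (0, 1, 0)"
  define F2 where "F2 = nm y2"
  define y1 where "y1 = (1, 0, 0) - pr F3 (1, 0, 0) - pr F2 (1, 0, 0)"
  define F1 where "F1 = nm y1"
  define k3 where "k3 = 1 / sqrt (h (0, 0, 1) (0, 0, 1))"
  have F3: "F3 = (0, 0, of_real k3)" by (simp add: F3_def nm_def k3_def scaleR_conv_of_real)
  have y2: "fst y2 = 0" "fst (snd y2) = 1"
    by (simp_all add: y2_def pr_def F3 times_i_def)
  define k2 where "k2 = 1 / sqrt (h y2 y2)"
  have F2: "F2 = (0, of_real k2, k2 *\<^sub>R snd (snd y2))"
    using y2 by (simp add: F2_def nm_def k2_def prod_eq_iff scaleR_conv_of_real)
  have y1: "fst y1 = 1"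
    by (simp add: y1_def pr_def F3 F2 times_i_def)
  define k1 where "k1 = 1 / sqrt (h y1 y1)"
  have F1: "F1 = (of_real k1, k1 *\<^sub>R fst (snd y1), k1 *\<^sub>R snd (snd y1))"
    using y1 by (simp add: F1_def nm_def k1_def prod_eq_iff scaleR_conv_of_real)
  have nz: "(0, 0, 1) \<noteq> (0 :: cvec)" "y2 \<noteq> 0" "y1 \<noteq> 0"
    using y1 y2 by (auto simp: prod_eq_iff)
  have k: "0 < k1" "0 < k2" "0 < k3"
    using hpos[OF nz(1)] hpos[OF nz(2)] hpos[OF nz(3)] by (simp_all add: k1_def k2_def k3_def)
  have u: "h F1 F1 = 1" "h F2 F2 = 1" "h F3 F3 = 1"
    unfolding F1_def F2_def F3_def by (rule nm nz)+
  have o23: "h F2 F3 = 0" "h F2 (times_i F3) = 0"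
    unfolding F2_def using prh[OF u(3)] by (auto intro!: nmz simp: y2_def)
  have o32: "h F3 F2 = 0" "h F3 (times_i F2) = 0"
    using o23 hsym[of F3] hL[of F2 F3] by auto
  have o13: "h F1 F3 = 0" "h F1 (times_i F3) = 0"
    unfolding F1_def using prh[OF u(3)] prz[OF o23] by (auto intro!: nmz simp: y1_def bil)
  \<comment> \<open>Subtracting the projections in the other order displays orthogonality to
    \<open>F2\<close>, as the definition of \<open>y1\<close> did for \<open>F3\<close>.\<close>
  have e: "y1 = ((1, 0, 0) - pr F2 (1, 0, 0)) - pr F3 (1, 0, 0)" by (simp add: y1_def)
  have o12: "h F1 F2 = 0" "h F1 (times_i F2) = 0"
    unfolding F1_def using prh[OF u(2)] prz[OF o32]
    by (auto intro!: nmz simp: e bilinear_lsub[OF bh, of "_ - _"])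
  have o: "h F3 F1 = 0" "h F3 (times_i F1) = 0" "h F2 F1 = 0" "h F2 (times_i F1) = 0"
    using o12 o13 hsym[of F3 F1] hsym[of F2 F1] hsym[of F3 "times_i F1"] hsym[of F2 "times_i F1"]
      hL[of F1 F3] hL[of F1 F2] by auto
  have iso: "h (cmap times_i F1 F2 F3 x) (cmap times_i F1 F2 F3 y) = x \<bullet> y" for x y
    unfolding cmap_def by (simp add: bil u o12 o13 o23 o32 o hL hxi ii bilinear_rneg[OF bh] inner_cvec)
  show ?thesis
    by (rule that[OF k, of "k1 *\<^sub>R fst (snd y1)" "k1 *\<^sub>R snd (snd y1)" "k2 *\<^sub>R snd (snd y2)"])
      (use iso in \<open>simp add: F1 F2 F3 h_def\<close>)
qed

section \<open>Complex algebra for the 2-step normal form\<close>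

lemma binary_quadratic_root:
  fixes A B C :: complex
  shows "\<exists>X Y. (X \<noteq> 0 \<or> Y \<noteq> 0) \<and> A * X\<^sup>2 + B * X * Y + C * Y\<^sup>2 = 0"
proof (cases "A = 0")
  case True
  thus ?thesis by (intro exI[of _ 1] exI[of _ 0]) simp
next
  case False
  define r where "r = csqrt (B\<^sup>2 - 4 * A * C)"
  have r: "r\<^sup>2 = B\<^sup>2 - 4 * A * C" by (simp add: r_def)
  have "A * ((r - B) / (2 * A))\<^sup>2 + B * ((r - B) / (2 * A)) * 1 + C * 1\<^sup>2 =
      (r\<^sup>2 - (B\<^sup>2 - 4 * A * C)) / (4 * A)"
    using False by (simp add: power2_eq_square field_simps)
  thus ?thesis using r by (intro exI[of _ "(r - B) / (2 * A)"] exI[of _ 1]) simp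
qed

lemma kernel_of_singular:
  fixes p1 p2 p3 p4 :: complex
  assumes "p1 * p4 = p2 * p3"
  shows "\<exists>y1 y2. (y1 \<noteq> 0 \<or> y2 \<noteq> 0) \<and> p1 * y1 + p2 * y2 = 0 \<and> p3 * y1 + p4 * y2 = 0"
proof (cases "p1 = 0 \<and> p2 = 0")
  case True
  show ?thesis
  proof (cases "p3 = 0 \<and> p4 = 0")
    case True
    with \<open>p1 = 0 \<and> p2 = 0\<close> show ?thesis by (intro exI[of _ 1] exI[of _ 0]) simp
  next
    case False
    with True show ?thesis by (intro exI[of _ p4] exI[of _ "- p3"]) auto
  qed
next
  case False
  thus ?thesis using assms by (intro exI[of _ p2] exI[of _ "- p1"]) (auto simp: mult.commute)
qed

section \<open>Minimal metrics\<close>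

context
  fixes \<mu> :: "'a::euclidean_space \<Rightarrow> 'a \<Rightarrow> 'a" and J :: "'a \<Rightarrow> 'a"
  assumes lie: "lie_bracket \<mu>" and abelian: "abelian_complex_structure \<mu> J" and dim: "DIM('a) = 6"
begin

lemma linear_J: "linear J"
  using abelian by (simp add: abelian_complex_structure_def complex_structure_def)

section \<open>Curvature bounds over all compatible metrics\<close>

lemma metric_values:
  fixes \<alpha> \<gamma> a b c :: complex
  assumes frame: "cframe \<mu> J \<alpha> \<gamma> a b c T" and g: "compatible_metric J g"
    and iso: "\<And>x y. g (T x) (T y) = x \<bullet> y"
  defines "X \<equiv> (norm \<alpha>)\<^sup>2" and "G \<equiv> (norm \<gamma>)\<^sup>2" and "B \<equiv> (norm a)\<^sup>2 + (norm b)\<^sup>2" and "C \<equiv> (norm c)\<^sup>2"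
  shows "2 * scalar_curvature \<mu> g = - (X + G + 2 * B + C)"
    and "8 * lin_trace (ricci_c \<mu> J g \<circ> ricci_c \<mu> J g) =
      4 * (X + G + B)\<^sup>2 + (X - 2 * B - 2 * C)\<^sup>2 + (G + 2 * B + C)\<^sup>2
      + 8 * (((\<gamma> + c) \<bullet> a)\<^sup>2 + ((\<gamma> + c) \<bullet> b)\<^sup>2) + 2 * X * G"
proof -
  have ip: "inner_product g" using g by (simp add: compatible_metric_def)
  show "2 * scalar_curvature \<mu> g = - (X + G + 2 * B + C)"
    using scalar_curvature_cframe[OF lie ip linear_J frame iso]
    by (simp add: X_def G_def B_def C_def)
  show "8 * lin_trace (ricci_c \<mu> J g \<circ> ricci_c \<mu> J g) =
      4 * (X + G + B)\<^sup>2 + (X - 2 * B - 2 * C)\<^sup>2 + (G + 2 * B + C)\<^sup>2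
      + 8 * (((\<gamma> + c) \<bullet> a)\<^sup>2 + ((\<gamma> + c) \<bullet> b)\<^sup>2) + 2 * X * G"
    using lin_trace_ricci_c_cframe[OF lie ip linear_J frame iso] lin_trace_cricci_c[of \<alpha> \<gamma> a b c]
    by (simp add: X_def G_def B_def C_def)
qed

text \<open>Once the scalar curvature is fixed the lower bound is a constant, so a metric attaining
  it is minimal.\<close>

lemma minimal_metricI:
  assumes low: "\<And>g. compatible_metric J g \<Longrightarrow>
      q * (scalar_curvature \<mu> g)\<^sup>2 \<le> lin_trace (ricci_c \<mu> J g \<circ> ricci_c \<mu> J g)"
    and "compatible_metric J g0"
      "lin_trace (ricci_c \<mu> J g0 \<circ> ricci_c \<mu> J g0) = q * (scalar_curvature \<mu> g0)\<^sup>2"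
  shows "minimal_metric \<mu> J g0"
  unfolding minimal_metric_def using assms by metis

text \<open>Makes every compatible metric standard in a frame obtained from the given one. Vanishing
  of \<open>\<alpha>\<close>, or of \<open>c\<close>, is preserved. The value of
  \<open>\<gamma>'\<close> is recorded for \<open>\<alpha> = 0\<close>, where the shift
  \<open>n\<close> drops out of it.\<close>

lemma orthonormal_cframe:
  assumes frame: "cframe \<mu> J \<alpha> \<gamma> a b c T" and g: "compatible_metric J g"
  obtains k1 k2 k3 :: real and l \<gamma>' T' where "0 < k1" "0 < k2" "0 < k3"
    "cframe \<mu> J ((k1\<^sup>2 / k2) *\<^sub>R \<alpha>) \<gamma>'
        ((k2 / k3) *\<^sub>R (k1 *\<^sub>R a - Im l *\<^sub>R c)) ((k2 / k3) *\<^sub>R (k1 *\<^sub>R b + Re l *\<^sub>R c))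
        ((k2\<^sup>2 / k3) *\<^sub>R c) T'"
    "\<alpha> = 0 \<Longrightarrow> \<gamma>' = (1 / k3) *\<^sub>R
        (k1\<^sup>2 *\<^sub>R \<gamma> - (2 * k1 * Im l) *\<^sub>R a + (2 * k1 * Re l) *\<^sub>R b + (norm l)\<^sup>2 *\<^sub>R c)"
    "\<And>x y. g (T' x) (T' y) = x \<bullet> y"
proof (rule gram_schmidt_cframe[OF frame g])
  fix k1 k2 k3 :: real and l m n
  let ?T = "T \<circ> cmap times_i (of_real k1, l, m) (0, of_real k2, n) (0, 0, of_real k3)"
  assume k: "0 < k1" "0 < k2" "0 < k3" and iso: "\<And>x y. g (?T x) (?T y) = x \<bullet> y"
  have nz: "k1 \<noteq> 0" "complex_of_real k2 \<noteq> 0" "complex_of_real k3 \<noteq> 0" using k by auto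
  have e: "z / complex_of_real r = (1 / r) *\<^sub>R z" for z r
    by (simp add: scaleR_conv_of_real)
  have e1: "of_real (k1\<^sup>2) * \<alpha> / of_real k2 = (k1\<^sup>2 / k2) *\<^sub>R \<alpha>"
    by (simp add: scaleR_conv_of_real)
  have e2: "(k1 *\<^sub>R (Re (of_real k2) *\<^sub>R a + Im (of_real k2) *\<^sub>R b) + Im (cnj l * of_real k2) *\<^sub>R c) / of_real k3
      = (k2 / k3) *\<^sub>R (k1 *\<^sub>R a - Im l *\<^sub>R c)"
    unfolding e by (simp add: complex_eq_iff) (simp add: field_simps)
  have e3: "(k1 *\<^sub>R (Re (of_real k2) *\<^sub>R b - Im (of_real k2) *\<^sub>R a) + Re (cnj l * of_real k2) *\<^sub>R c) / of_real k3
      = (k2 / k3) *\<^sub>R (k1 *\<^sub>R b + Re l *\<^sub>R c)"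
    unfolding e by (simp add: complex_eq_iff) (simp add: field_simps)
  have e4: "(norm (complex_of_real k2))\<^sup>2 *\<^sub>R c / of_real k3 = (k2\<^sup>2 / k3) *\<^sub>R c"
    unfolding e by simp
  show thesis
  proof (rule that[OF k _ _ iso])
    show "cframe \<mu> J ((k1\<^sup>2 / k2) *\<^sub>R \<alpha>)
        ((k1\<^sup>2 *\<^sub>R \<gamma> - (2 * k1 * Im l) *\<^sub>R a + (2 * k1 * Re l) *\<^sub>R b + (norm l)\<^sup>2 *\<^sub>R c
          - (k1\<^sup>2 / k2) *\<^sub>R \<alpha> * n) / of_real k3)
        ((k2 / k3) *\<^sub>R (k1 *\<^sub>R a - Im l *\<^sub>R c)) ((k2 / k3) *\<^sub>R (k1 *\<^sub>R b + Re l *\<^sub>R c))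
        ((k2\<^sup>2 / k3) *\<^sub>R c) ?T"
      using cframe_triangular[OF lie abelian dim frame nz, of l n m] unfolding e1 e2 e3 e4 .
  qed (simp add: e)
qed

text \<open>For \<open>X = 0\<close> put p = G + B and q = B + C. The diagonal part exceeds 3 (p +
  q)^2 by 4 p^2 + 4 q^2 - 2 (p + q)^2 = 2 (G - C)^2. Equality thus needs G = C and no off-diagonal
  terms.\<close>

lemma trace_bound_\<alpha>_0:
  assumes frame: "cframe \<mu> J 0 \<gamma> a b c T" and g: "compatible_metric J g"
  shows "3 / 2 * (scalar_curvature \<mu> g)\<^sup>2 \<le> lin_trace (ricci_c \<mu> J g \<circ> ricci_c \<mu> J g)"
proof -
  obtain k1 k2 k3 :: real and l \<gamma>' T' where fr: "cframe \<mu> J ((k1\<^sup>2 / k2) *\<^sub>R 0) \<gamma>'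
        ((k2 / k3) *\<^sub>R (k1 *\<^sub>R a - Im l *\<^sub>R c)) ((k2 / k3) *\<^sub>R (k1 *\<^sub>R b + Re l *\<^sub>R c))
        ((k2\<^sup>2 / k3) *\<^sub>R c) T'"
    and iso: "\<And>x y. g (T' x) (T' y) = x \<bullet> y"
    using orthonormal_cframe[OF frame g] by metis
  have "3 * (2 * scalar_curvature \<mu> g)\<^sup>2 \<le> 8 * lin_trace (ricci_c \<mu> J g \<circ> ricci_c \<mu> J g)"
  proof -
    have "3 * (- (X + G + 2 * B + C))\<^sup>2 \<le> 4 * (X + G + B)\<^sup>2 + (X - 2 * B - 2 * C)\<^sup>2 + (G + 2 * B + C)\<^sup>2
      + 8 * (r\<^sup>2 + s\<^sup>2) + 2 * X * G" if "X = 0" for X G B C r s :: real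
    proof -
      have "0 \<le> 2 * (G - C)\<^sup>2 + 8 * (r\<^sup>2 + s\<^sup>2)" by simp
      thus ?thesis by (simp add: that power2_eq_square algebra_simps)
    qed
    thus ?thesis unfolding metric_values[OF fr g iso] by this simp
  qed
  thus ?thesis by (simp add: power_mult_distrib)
qed

text \<open>For \<open>C = 0\<close> the difference is 8 (X - B)^2 plus nonnegative terms, all of
  which vanish when G = 0 and the off-diagonal terms are zero. Equality is therefore reached at X =
  B, G = 0.\<close>

lemma trace_bound_c_0:
  assumes frame: "cframe \<mu> J \<alpha> \<gamma> a b 0 T" and g: "compatible_metric J g"
  shows "7 / 6 * (scalar_curvature \<mu> g)\<^sup>2 \<le> lin_trace (ricci_c \<mu> J g \<circ> ricci_c \<mu> J g)"
proof -
  obtain k1 k2 k3 :: real and l \<gamma>' T' where fr: "cframe \<mu> J ((k1\<^sup>2 / k2) *\<^sub>R \<alpha>) \<gamma>'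
        ((k2 / k3) *\<^sub>R (k1 *\<^sub>R a - Im l *\<^sub>R 0)) ((k2 / k3) *\<^sub>R (k1 *\<^sub>R b + Re l *\<^sub>R 0))
        ((k2\<^sup>2 / k3) *\<^sub>R 0) T'"
    and iso: "\<And>x y. g (T' x) (T' y) = x \<bullet> y"
    using orthonormal_cframe[OF frame g] by metis
  have "7 * (2 * scalar_curvature \<mu> g)\<^sup>2 \<le> 24 * lin_trace (ricci_c \<mu> J g \<circ> ricci_c \<mu> J g)"
  proof -
    have "7 * (- (X + G + 2 * B + C))\<^sup>2 \<le> 3 * (4 * (X + G + B)\<^sup>2 + (X - 2 * B - 2 * C)\<^sup>2 + (G + 2 * B + C)\<^sup>2
      + 8 * (r\<^sup>2 + s\<^sup>2) + 2 * X * G)" if "0 \<le> X" "0 \<le> G" "0 \<le> B" "C = 0" for X G B C r s :: real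
    proof -
      have "0 \<le> 8 * (X - B)\<^sup>2 + 8 * G\<^sup>2 + 16 * (X * G) + 8 * (G * B) + 24 * (r\<^sup>2 + s\<^sup>2)"
        using that by simp
      thus ?thesis by (simp add: that(4) power2_eq_square algebra_simps)
    qed
    hence "7 * (2 * scalar_curvature \<mu> g)\<^sup>2 \<le> 3 * (8 * lin_trace (ricci_c \<mu> J g \<circ> ricci_c \<mu> J g))"
      unfolding metric_values[OF fr g iso] by this simp_all
    thus ?thesis by simp
  qed
  thus ?thesis by (simp add: power_mult_distrib)
qed

text \<open>Triangular changes leave only \<open>\<gamma>\<close> possibly nonzero, so both sides
  are multiples of the square of G.\<close>

lemma trace_abelian_or_heisenberg:
  assumes frame: "cframe \<mu> J 0 \<gamma> 0 0 0 T" and g: "compatible_metric J g"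
  shows "lin_trace (ricci_c \<mu> J g \<circ> ricci_c \<mu> J g) = 5 / 2 * (scalar_curvature \<mu> g)\<^sup>2"
proof -
  obtain k1 k2 k3 :: real and l \<gamma>' T' where fr: "cframe \<mu> J ((k1\<^sup>2 / k2) *\<^sub>R 0) \<gamma>'
        ((k2 / k3) *\<^sub>R (k1 *\<^sub>R 0 - Im l *\<^sub>R 0)) ((k2 / k3) *\<^sub>R (k1 *\<^sub>R 0 + Re l *\<^sub>R 0))
        ((k2\<^sup>2 / k3) *\<^sub>R 0) T'"
    and iso: "\<And>x y. g (T' x) (T' y) = x \<bullet> y"
    using orthonormal_cframe[OF frame g] by metis
  have "8 * lin_trace (ricci_c \<mu> J g \<circ> ricci_c \<mu> J g) = 5 * (2 * scalar_curvature \<mu> g)\<^sup>2"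
    unfolding metric_values[OF fr g iso] by simp
  thus ?thesis by (simp add: power_mult_distrib)
qed

section \<open>Existence and non-existence of minimal metrics\<close>

lemma minimal_metric_abelian_or_heisenberg:
  assumes "cframe \<mu> J 0 \<gamma> 0 0 0 T"
  shows "\<exists>g. minimal_metric \<mu> J g"
proof -
  obtain g where g: "compatible_metric J g" and "\<And>x y. g (T x) (T y) = x \<bullet> y"
    using compatible_metric_cframe[OF assms] by blast
  have tr: "lin_trace (ricci_c \<mu> J g' \<circ> ricci_c \<mu> J g') = 5 / 2 * (scalar_curvature \<mu> g')\<^sup>2"
    if "compatible_metric J g'" for g'
    by (rule trace_abelian_or_heisenberg[OF assms that])
  have "minimal_metric \<mu> J g"
    unfolding minimal_metric_def
  proof (intro conjI allI impI g)
    fix g'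
    assume g': "compatible_metric J g' \<and> scalar_curvature \<mu> g' = scalar_curvature \<mu> g"
    hence "lin_trace (ricci_c \<mu> J g \<circ> ricci_c \<mu> J g) = lin_trace (ricci_c \<mu> J g' \<circ> ricci_c \<mu> J g')"
      using tr[OF g] tr[of g'] by (simp only:)
    thus "lin_trace (ricci_c \<mu> J g \<circ> ricci_c \<mu> J g) \<le> lin_trace (ricci_c \<mu> J g' \<circ> ricci_c \<mu> J g')"
      by (rule eq_refl)
  qed
  thus ?thesis by blast
qed

text \<open>The hypotheses are the equality case of the bound with factor 3/2, realized by the
  metric in which \<open>T\<close> is unitary.\<close>

lemma minimal_metric_balanced:
  assumes frame: "cframe \<mu> J 0 \<gamma> a b c T" and "norm \<gamma> = norm c" "(\<gamma> + c) \<bullet> a = 0" "(\<gamma> + c) \<bullet> b = 0"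
  shows "\<exists>g. minimal_metric \<mu> J g"
proof -
  obtain g where g: "compatible_metric J g" and iso: "\<And>x y. g (T x) (T y) = x \<bullet> y"
    using compatible_metric_cframe[OF frame] by blast
  have "8 * lin_trace (ricci_c \<mu> J g \<circ> ricci_c \<mu> J g) = 3 * (2 * scalar_curvature \<mu> g)\<^sup>2"
    unfolding metric_values[OF frame g iso] assms(2-4) by (simp add: power2_eq_square algebra_simps)
  hence "minimal_metric \<mu> J g"
    by (intro minimal_metricI[of "3/2"] g trace_bound_\<alpha>_0[OF frame]) (simp_all add: power_mult_distrib)
  thus ?thesis by blast
qed

text \<open>Rescaling leads to X = B = 1 and G = 0, where the bound with factor 7/6 is
  attained.\<close>

lemma minimal_metric_three_step:
  assumes frame: "cframe \<mu> J \<alpha> \<gamma> a b 0 T" and \<alpha>: "\<alpha> \<noteq> 0" and ab: "a \<noteq> 0 \<or> b \<noteq> 0"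
  shows "\<exists>g. minimal_metric \<mu> J g"
proof -
  define B where "B = (norm a)\<^sup>2 + (norm b)\<^sup>2"
  define k where "k = norm \<alpha> * sqrt B"
  have B: "B > 0" using ab by (auto simp: B_def add_pos_nonneg add_nonneg_pos)
  have k: "k > 0" "k\<^sup>2 = (norm \<alpha>)\<^sup>2 * B" using \<alpha> B by (simp_all add: k_def power_mult_distrib)
  define a' where "a' = (Re \<alpha> *\<^sub>R a + Im \<alpha> *\<^sub>R b) / k"
  define b' where "b' = (Re \<alpha> *\<^sub>R b - Im \<alpha> *\<^sub>R a) / k"
  have nz: "(1::real) \<noteq> 0" "\<alpha> \<noteq> 0" "complex_of_real k \<noteq> 0" using \<alpha> k by auto
  \<comment> \<open>The second vector \<open>(0, \<alpha>, \<gamma>)\<close> is the bracket of the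
    first with its multiple by \<open>\<i>\<close>, hence the parameters 1 and 0. The scale
    \<open>k\<close> normalizes the remaining ones to total squared length 1.\<close>
  have "cframe \<mu> J 1 0 a' b' 0 (T \<circ> cmap times_i (1, 0, 0) (0, \<alpha>, \<gamma>) (0, 0, of_real k))"
    using cframe_triangular[OF lie abelian dim frame nz, of 0 \<gamma> 0] \<alpha> by (simp add: a'_def b'_def)
  then obtain T1 where fr: "cframe \<mu> J 1 0 a' b' 0 T1" by blast
  have "(norm (Re \<alpha> *\<^sub>R a + Im \<alpha> *\<^sub>R b))\<^sup>2 + (norm (Re \<alpha> *\<^sub>R b - Im \<alpha> *\<^sub>R a))\<^sup>2 = k\<^sup>2"
    unfolding k B_def cmod_power2 by (simp add: power2_eq_square algebra_simps)
  hence 1: "(norm a')\<^sup>2 + (norm b')\<^sup>2 = 1"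
    using k(1) by (simp add: a'_def b'_def norm_divide power_divide flip: add_divide_distrib)
  obtain g where g: "compatible_metric J g"
    and iso: "\<And>x y. g (T1 x) (T1 y) = x \<bullet> y"
    using compatible_metric_cframe[OF fr] by blast
  have "8 * lin_trace (ricci_c \<mu> J g \<circ> ricci_c \<mu> J g) = 21" "2 * scalar_curvature \<mu> g = - 3"
    unfolding metric_values[OF fr g iso] 1 by simp_all
  hence "scalar_curvature \<mu> g = - 3 / 2" "lin_trace (ricci_c \<mu> J g \<circ> ricci_c \<mu> J g) = 21 / 8" by simp_all
  hence "minimal_metric \<mu> J g"
    by (intro minimal_metricI[of "7/6"] g trace_bound_c_0[OF frame]) (simp_all add: power2_eq_square)
  thus ?thesis by blast
qed

text \<open>For every compatible metric G > 0, and the trace is at least that of a metric without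
  off-diagonal terms having the same G and N = G + 2 B. Rescaling the frame lowers G while N stays
  fixed, so no metric is optimal.\<close>

lemma no_minimal_metric_exceptional:
  assumes frame: "cframe \<mu> J 0 1 0 (-\<i>) 0 T"
  shows "\<not> minimal_metric \<mu> J g"
proof
  assume min: "minimal_metric \<mu> J g"
  hence g: "compatible_metric J g" by (simp add: minimal_metric_def)
  obtain k1 k2 k3 :: real and l \<gamma> T' where k: "0 < k1" "0 < k2" "0 < k3"
    and fr0: "cframe \<mu> J ((k1\<^sup>2 / k2) *\<^sub>R 0) \<gamma>
        ((k2 / k3) *\<^sub>R (k1 *\<^sub>R 0 - Im l *\<^sub>R 0)) ((k2 / k3) *\<^sub>R (k1 *\<^sub>R (-\<i>) + Re l *\<^sub>R 0))
        ((k2\<^sup>2 / k3) *\<^sub>R 0) T'"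
    and \<gamma>: "\<gamma> = (1 / k3) *\<^sub>R
        (k1\<^sup>2 *\<^sub>R 1 - (2 * k1 * Im l) *\<^sub>R 0 + (2 * k1 * Re l) *\<^sub>R (-\<i>) + (norm l)\<^sup>2 *\<^sub>R 0)"
    and iso: "\<And>x y. g (T' x) (T' y) = x \<bullet> y"
    using orthonormal_cframe[OF frame g] by metis
  define \<beta> where "\<beta> = (k2 / k3) *\<^sub>R (k1 *\<^sub>R (-\<i>))"
  have fr: "cframe \<mu> J 0 \<gamma> 0 \<beta> 0 T'" using fr0 by (simp add: \<beta>_def)
  define G where "G = (norm \<gamma>)\<^sup>2"
  define B where "B = (norm \<beta>)\<^sup>2"
  define N where "N = G + 2 * B"
  \<comment> \<open>Since \<open>b\<close> is imaginary, the shift by \<open>l\<close> changes only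
    the imaginary part of \<open>\<gamma>\<close>, and the real part remains
    \<open>k1\<^sup>2 / k3\<close>.\<close>
  have "Re \<gamma> \<noteq> 0" using k by (simp add: \<gamma>)
  hence "G > 0" by (auto simp: G_def)
  hence N: "N > 0" by (simp add: N_def B_def add_pos_nonneg)
  have sc: "2 * scalar_curvature \<mu> g = - N"
    unfolding metric_values(1)[OF fr g iso] by (simp add: N_def G_def B_def)
  have "8 * lin_trace (ricci_c \<mu> J g \<circ> ricci_c \<mu> J g) =
      4 * (G + B)\<^sup>2 + 4 * B\<^sup>2 + (G + 2 * B)\<^sup>2 + 8 * (\<gamma> \<bullet> \<beta>)\<^sup>2"
    unfolding metric_values(2)[OF fr g iso] by (simp add: G_def B_def power_mult_distrib)
  also have "\<dots> = 3 * N\<^sup>2 + 2 * G\<^sup>2 + 8 * (\<gamma> \<bullet> \<beta>)\<^sup>2"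
    by (simp add: N_def power2_eq_square algebra_simps)
  finally have lower: "3 * N\<^sup>2 + 2 * G\<^sup>2 \<le> 8 * lin_trace (ricci_c \<mu> J g \<circ> ricci_c \<mu> J g)"
    by simp
  \<comment> \<open>The new metric has G1 = s^2 B1. The choice of \<open>t\<close> forces G1 + 2 B1
    = N, whence B1 < N, and s^2 = G / N then gives G1 < G.\<close>
  define s where "s = sqrt (G / N)"
  define t where "t = sqrt ((s^4 + 2 * s\<^sup>2) / N)"
  have s: "s > 0" "s\<^sup>2 = G / N" using \<open>G > 0\<close> N by (simp_all add: s_def)
  have p: "0 < (s^4 + 2 * s\<^sup>2) / N"
    using s(1) N by (intro divide_pos_pos add_pos_pos) simp_all
  have t: "t > 0" "t\<^sup>2 = (s^4 + 2 * s\<^sup>2) / N" using p by (simp_all add: t_def)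
  have nz: "s \<noteq> 0" "(1::complex) \<noteq> 0" "complex_of_real t \<noteq> 0" using s t by auto
  have "cframe \<mu> J 0 (of_real (s\<^sup>2 / t)) 0 (of_real (s / t) * (-\<i>)) 0
      (T \<circ> cmap times_i (of_real s, 0, 0) (0, 1, 0) (0, 0, of_real t))"
    using cframe_triangular[OF lie abelian dim frame nz, of 0 0 0]
    by (simp add: scaleR_conv_of_real)
  then obtain T1 where fr1: "cframe \<mu> J 0 (of_real (s\<^sup>2 / t)) 0 (of_real (s / t) * (-\<i>)) 0 T1"
    by blast
  obtain g1 where g1: "compatible_metric J g1" and iso1: "\<And>x y. g1 (T1 x) (T1 y) = x \<bullet> y"
    using compatible_metric_cframe[OF fr1] by blast
  define G1 where "G1 = s^4 / t\<^sup>2"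
  define B1 where "B1 = s\<^sup>2 / t\<^sup>2"
  have nr: "(norm (complex_of_real r))\<^sup>2 = r\<^sup>2" "(norm (of_real r * (-\<i>)))\<^sup>2 = r\<^sup>2" for r
    by (simp_all add: norm_mult)
  have n: "(norm (complex_of_real (s\<^sup>2 / t)))\<^sup>2 = G1" "(norm (of_real (s / t) * (-\<i>)))\<^sup>2 = B1"
    unfolding nr by (simp_all add: G1_def B1_def power_divide flip: power_mult)
  have N1: "G1 + 2 * B1 = N"
  proof -
    have "s^4 + 2 * s\<^sup>2 > 0" using s(1) by (intro add_pos_pos) simp_all
    moreover have "G1 + 2 * B1 = (s^4 + 2 * s\<^sup>2) / t\<^sup>2" by (simp add: G1_def B1_def add_divide_distrib)
    ultimately show ?thesis using N by (simp add: t(2))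
  qed
  have "scalar_curvature \<mu> g1 = scalar_curvature \<mu> g"
  proof -
    have "2 * scalar_curvature \<mu> g1 = - (G1 + 2 * B1)"
      unfolding metric_values(1)[OF fr1 g1 iso1] n by simp
    thus ?thesis using sc N1 by linarith
  qed
  hence "lin_trace (ricci_c \<mu> J g \<circ> ricci_c \<mu> J g) \<le> lin_trace (ricci_c \<mu> J g1 \<circ> ricci_c \<mu> J g1)"
    using min g1 by (simp add: minimal_metric_def)
  moreover have "8 * lin_trace (ricci_c \<mu> J g1 \<circ> ricci_c \<mu> J g1) = 3 * N\<^sup>2 + 2 * G1\<^sup>2"
    unfolding metric_values(2)[OF fr1 g1 iso1] n N1[symmetric]
    by (simp add: inner_complex_def power2_eq_square algebra_simps)
  moreover have "G1 < G"
  proof -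
    have "G1 = s\<^sup>2 * B1" by (simp add: G1_def B1_def power4_eq_xxxx power2_eq_square)
    moreover have "B1 < N"
    proof -
      have "0 < G1" "0 \<le> B1" using s(1) t(1) by (simp_all add: G1_def B1_def)
      thus ?thesis using N1 by linarith
    qed
    moreover have "s\<^sup>2 * N = G" using N by (simp add: s(2))
    ultimately show ?thesis using s(1) mult_strict_left_mono[of B1 N "s\<^sup>2"] by simp
  qed
  moreover have "0 \<le> G1" by (simp add: G1_def)
  ultimately show False using lower power_strict_mono[of G1 G 2] by simp
qed

section \<open>Normal forms of 2-step brackets\<close>

text \<open>With \<open>\<alpha> = 0\<close> the bracket takes values in the central line of the
  third vector, so the first two vectors admit any invertible complex change, not only a triangular
  one.\<close>

lemma cframe_change_generators:
  fixes x1 x2 y1 y2 :: complex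
  assumes frame: "cframe \<mu> J 0 \<gamma> a b c T" and det: "x1 * y2 \<noteq> x2 * y1"
  defines "q \<equiv> \<lambda>x y. snd (snd (cbracket 0 \<gamma> a b c x y))"
  shows "\<exists>T'. cframe \<mu> J 0 (q (x1, x2, 0) (times_i (x1, x2, 0))) (q (x1, x2, 0) (y1, y2, 0))
    (q (x1, x2, 0) (times_i (y1, y2, 0))) (q (y1, y2, 0) (times_i (y1, y2, 0))) T'"
proof (rule exI, rule cframe_change[OF lie abelian dim frame,
      where ?F1.0 = "(x1, x2, 0)" and ?F2.0 = "(y1, y2, 0)" and ?F3.0 = "(0, 0, 1)"])
  show "x = 0" if "cmap times_i (x1, x2, 0) (y1, y2, 0) (0, 0, 1) x = 0" for x
  proof -
    obtain u v w where x: "x = (u, v, w)" by (cases x) auto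
    have e: "u * x1 + v * y1 = 0" "u * x2 + v * y2 = 0" "w = 0"
      using that by (auto simp: x cmap_times_i_apply zero_prod_def)
    \<comment> \<open>Cramer's rule for the two equations in \<open>u\<close> and
      \<open>v\<close>.\<close>
    have "u * (x1 * y2 - x2 * y1) = (u * x1 + v * y1) * y2 - (u * x2 + v * y2) * y1"
      "v * (x1 * y2 - x2 * y1) = (u * x2 + v * y2) * x1 - (u * x1 + v * y1) * x2"
      by (simp_all add: algebra_simps)
    hence "u * (x1 * y2 - x2 * y1) = 0" "v * (x1 * y2 - x2 * y1) = 0" unfolding e by simp_all
    thus ?thesis using det e(3) by (simp add: x zero_prod_def)
  qed
  show "cbracket 0 \<gamma> a b c x (0, 0, 1) = 0" for x
    by (simp add: cbracket_def zero_prod_def)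
qed (simp_all add: q_def cmap_times_i_apply cbracket_def Let_def)

text \<open>For fixed x the map sending y to \<open>q x y\<close> splits into a linear and an
  antilinear part. A root of a quadratic form gives x for which both parts kill a common nonzero y.
  If x and y are independent they serve as generators with \<open>a' = b' = 0\<close>; otherwise x
  is isotropic and serves as second generator with \<open>c' = 0\<close>.\<close>

lemma two_step_normal_form:
  assumes frame: "cframe \<mu> J 0 \<gamma> a b c T"
  obtains \<gamma>' a' b' c' T' where "cframe \<mu> J 0 \<gamma>' a' b' c' T'" "c' = 0 \<or> (a' = 0 \<and> b' = 0)"
proof -
  define q where "q x y = snd (snd (cbracket 0 \<gamma> a b c x y))" for x y
  note change = cframe_change_generators[OF frame, folded q_def]
  obtain X Y :: complex where XY: "X \<noteq> 0 \<or> Y \<noteq> 0"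
    and root: "(\<gamma> * (\<i> * cnj a + cnj b) - (\<i> * a + b) * cnj \<gamma>) * X\<^sup>2
      + (\<gamma> * cnj c - (\<i> * a - b) * (\<i> * cnj a + cnj b) + (\<i> * a + b) * (\<i> * cnj a - cnj b) - c * cnj \<gamma>) * X * Y
      + (c * (\<i> * cnj a - cnj b) - (\<i> * a - b) * cnj c) * Y\<^sup>2 = 0"
    using binary_quadratic_root by blast
  \<comment> \<open>The quadratic form is the determinant of the two linear forms in y, written in
    the conjugates \<open>X\<close>, \<open>Y\<close> of the coordinates of x.\<close>
  have "(\<gamma> * X - (\<i> * a - b) * Y) * ((\<i> * cnj a + cnj b) * X + cnj c * Y)
      - ((\<i> * a + b) * X + c * Y) * (cnj \<gamma> * X - (\<i> * cnj a - cnj b) * Y) = 0"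
    unfolding root[symmetric] by (simp only: power2_eq_square) (simp add: algebra_simps)
  hence "(\<gamma> * X - (\<i> * a - b) * Y) * ((\<i> * cnj a + cnj b) * X + cnj c * Y)
      = ((\<i> * a + b) * X + c * Y) * (cnj \<gamma> * X - (\<i> * cnj a - cnj b) * Y)" by simp
  from kernel_of_singular[OF this] obtain y1 y2 where y: "y1 \<noteq> 0 \<or> y2 \<noteq> 0"
    and e1: "(\<gamma> * X - (\<i> * a - b) * Y) * y1 + ((\<i> * a + b) * X + c * Y) * y2 = 0"
    and e2: "(cnj \<gamma> * X - (\<i> * cnj a - cnj b) * Y) * y1 + ((\<i> * cnj a + cnj b) * X + cnj c * Y) * y2 = 0"
    by blast
  define x1 where "x1 = cnj X"
  define x2 where "x2 = cnj Y"
  \<comment> \<open>The two linear forms are, up to the factor \<open>2 \<i>\<close>, the complex linear part of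
    \<open>y \<mapsto> q x y\<close> and the conjugate of its antilinear part.\<close>
  have split: "2 * \<i> * q (x1, x2, 0) (z1, z2, 0) =
      ((\<gamma> * X - (\<i> * a - b) * Y) * z1 + ((\<i> * a + b) * X + c * Y) * z2)
      - cnj ((cnj \<gamma> * X - (\<i> * cnj a - cnj b) * Y) * z1 + ((\<i> * cnj a + cnj b) * X + cnj c * Y) * z2)"
    for z1 z2
    by (simp add: q_def cbracket_def Let_def x1_def x2_def complex_eq_iff) (simp add: algebra_simps)
  have q0: "q (x1, x2, 0) (y1, y2, 0) = 0"
    using split[of y1 y2] unfolding e1 e2 by simp
  \<comment> \<open>Both forms are complex linear, so multiplying y by \<open>\<i>\<close> stays in
    their common kernel.\<close>
  have q1: "q (x1, x2, 0) (times_i (y1, y2, 0)) = 0"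
  proof -
    have "p * (\<i> * y1) + r * (\<i> * y2) = \<i> * (p * y1 + r * y2)" for p r
      by (simp add: algebra_simps)
    thus ?thesis using split[of "\<i> * y1" "\<i> * y2"] e1 e2 by (simp add: times_i_def)
  qed
  show ?thesis
  proof (cases "x1 * y2 = x2 * y1")
    case False
    from change[OF this] that show ?thesis unfolding q0 q1 by blast
  next
    case True
    have x: "x1 \<noteq> 0 \<or> x2 \<noteq> 0" using XY by (auto simp: x1_def x2_def)
    obtain r where r: "y1 = r * x1" "y2 = r * x2"
    proof (cases "x1 = 0")
      case True
      with x \<open>x1 * y2 = x2 * y1\<close> show ?thesis using that[of "y2 / x2"] by auto
    next
      case False
      with \<open>x1 * y2 = x2 * y1\<close> show ?thesis using that[of "y1 / x1"] by (auto simp: field_simps)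
    qed
    have "r \<noteq> 0" using y r by auto
    have i0: "q (x1, x2, 0) (times_i (x1, x2, 0)) = 0"
    proof -
      let ?v = "q (x1, x2, 0) (times_i (x1, x2, 0))"
      have "q (x1, x2, 0) (y1, y2, 0) = Im r *\<^sub>R ?v"
        "q (x1, x2, 0) (times_i (y1, y2, 0)) = Re r *\<^sub>R ?v"
        unfolding r by (simp_all add: q_def cbracket_def Let_def times_i_def complex_eq_iff)
          (simp_all add: algebra_simps)
      thus ?thesis using q0 q1 \<open>r \<noteq> 0\<close> by (auto simp: complex_eq_iff)
    qed
    obtain z1 z2 where "z1 * x2 \<noteq> z2 * x1"
    proof (cases "x1 = 0")
      case True thus ?thesis using x that[of 1 0] by simp
    next
      case False thus ?thesis using that[of 0 1] by simp
    qed
    from change[OF this] that i0 show ?thesis by metis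
  qed
qed

text \<open>If \<open>a\<close> and \<open>b\<close> are independent over the reals, a shift of the
  first vector removes \<open>\<gamma>\<close>. If they are dependent and not both zero, a complex
  multiple of the second vector makes \<open>a = 0\<close>, and the shift leaves only an imaginary
  multiple of the new \<open>b\<close>. When nonzero, it can be rescaled to the exceptional
  parameters.\<close>

lemma minimal_metric_or_exceptional:
  assumes frame: "cframe \<mu> J 0 \<gamma> a b 0 T"
  shows "(\<exists>g. minimal_metric \<mu> J g) \<or> (\<exists>T. cframe \<mu> J 0 1 0 (-\<i>) 0 T)"
proof (cases "a = 0 \<and> b = 0")
  case True
  thus ?thesis using minimal_metric_abelian_or_heisenberg frame by blast
next
  case ab: False
  have bal: "\<exists>g. minimal_metric \<mu> J g" if "cframe \<mu> J 0 0 a b 0 T" for a b T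
    using minimal_metric_balanced[OF that] by simp
  have one: "(1::real) \<noteq> 0" "(1::complex) \<noteq> 0" by simp_all
  show ?thesis
  proof (cases "Im (cnj a * b) = 0")
    case False
    \<comment> \<open>Coordinates of \<open>\<gamma>\<close> in the real basis \<open>a\<close>,
      \<open>b\<close> of the complex plane, by Cramer's rule.\<close>
    define s where "s = Im (cnj \<gamma> * b) / Im (cnj a * b)"
    define t where "t = Im (cnj a * \<gamma>) / Im (cnj a * b)"
    have g: "\<gamma> = s *\<^sub>R a + t *\<^sub>R b"
    proof -
      have "Im (cnj a * b) *\<^sub>R \<gamma> = Im (cnj \<gamma> * b) *\<^sub>R a + Im (cnj a * \<gamma>) *\<^sub>R b"
        by (simp add: complex_eq_iff algebra_simps)
      hence "\<gamma> = (1 / Im (cnj a * b)) *\<^sub>R (Im (cnj \<gamma> * b) *\<^sub>R a + Im (cnj a * \<gamma>) *\<^sub>R b)"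
        using False by (metis divide_self_if divideR_right scaleR_one inverse_eq_divide)
      thus ?thesis by (simp add: s_def t_def scaleR_add_right)
    qed
    have "\<gamma> - s *\<^sub>R a - t *\<^sub>R b = 0" using g by simp
    hence "\<exists>T. cframe \<mu> J 0 0 a b 0 T"
      using cframe_triangular[OF lie abelian dim frame one one(2), of "Complex (- t / 2) (s / 2)" 0 0]
      by auto
    thus ?thesis using bal by blast
  next
    case True
    \<comment> \<open>With \<open>b = r *\<^sub>R a\<close> and \<open>a\<close> nonzero, the factor
      \<open>Complex (- r) 1\<close> cancels the new \<open>a\<close> and gives a new
      \<open>b\<close> equal to -(r^2 + 1) a.\<close>
    obtain k where k: "k \<noteq> 0" "Re k *\<^sub>R a + Im k *\<^sub>R b = 0" "Re k *\<^sub>R b - Im k *\<^sub>R a \<noteq> 0"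
    proof (cases "a = 0")
      case a: True
      thus ?thesis using ab that[of 1] by simp
    next
      case a: False
      define r where "r = (a \<bullet> b) / (norm a)\<^sup>2"
      have "(norm a)\<^sup>2 *\<^sub>R b = (a \<bullet> b) *\<^sub>R a"
      proof (rule complex_eqI)
        have e: "Re a * Im b = Im a * Re b" using True by simp
        show "Re ((norm a)\<^sup>2 *\<^sub>R b) = Re ((a \<bullet> b) *\<^sub>R a)"
          using arg_cong[OF e, of "\<lambda>t. t * Im a"]
          by (simp add: inner_complex_def cmod_power2) (auto simp: power2_eq_square algebra_simps)
        show "Im ((norm a)\<^sup>2 *\<^sub>R b) = Im ((a \<bullet> b) *\<^sub>R a)"
          using arg_cong[OF e, of "\<lambda>t. t * Re a"]
          by (simp add: inner_complex_def cmod_power2) (auto simp: power2_eq_square algebra_simps)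
      qed
      hence "(1 / (norm a)\<^sup>2) *\<^sub>R (norm a)\<^sup>2 *\<^sub>R b = r *\<^sub>R a" by (simp add: r_def)
      hence b: "b = r *\<^sub>R a" using a by simp
      have "(r * r + 1) *\<^sub>R a \<noteq> 0"
        using a sum_squares_gt_zero_iff[of r 1] by simp
      moreover have "- (r * r) *\<^sub>R a - a = - ((r * r + 1) *\<^sub>R a)" by (simp add: algebra_simps)
      ultimately have "- (r * r) *\<^sub>R a - a \<noteq> 0" by simp
      thus ?thesis using that[of "Complex (- r) 1"] by (simp add: b complex_eq_iff)
    qed
    have frame1: "cframe \<mu> J 0 \<gamma> 0 (Re k *\<^sub>R b - Im k *\<^sub>R a) 0
        (T \<circ> cmap times_i (of_real 1, 0, 0) (0, k, 0) (0, 0, 1))"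
      using cframe_triangular[OF lie abelian dim frame one(1) k(1) one(2), of 0 0 0] k(2) by simp
    define b' where "b' = Re k *\<^sub>R b - Im k *\<^sub>R a"
    have b': "b' \<noteq> 0" using k(3) by (simp add: b'_def)
    define z where "z = \<gamma> / b'"
    have z: "\<gamma> = z * b'" using b' by (simp add: z_def)
    have r: "\<gamma> + (2 * Re (of_real (- Re z / 2))) *\<^sub>R b' = Im z *\<^sub>R (\<i> * b')"
      by (simp add: z complex_eq_iff algebra_simps)
    obtain T2 where frame2: "cframe \<mu> J 0 (Im z *\<^sub>R (\<i> * b')) 0 b' 0 T2"
      using cframe_triangular[OF lie abelian dim frame1[folded b'_def] one one(2),
          of "of_real (- Re z / 2)" 0 0] r by auto
    show ?thesis
    proof (cases "Im z = 0")
      case True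
      with frame2 show ?thesis using bal[of 0 b' T2] by simp
    next
      case False
      hence nz: "complex_of_real (Im z) \<noteq> 0" "Im z *\<^sub>R (\<i> * b') \<noteq> 0" using b' by simp_all
      \<comment> \<open>The second vector is scaled by \<open>Im z\<close> and the third by the
        current \<open>\<gamma>\<close>, which sends \<open>\<gamma>\<close> to 1 and
        \<open>b\<close> to \<open>-\<i>\<close>.\<close>
      have "Im z *\<^sub>R b' / (Im z *\<^sub>R (\<i> * b')) = - \<i>"
        using nz b' False by (simp add: scaleR_conv_of_real field_simps)
      hence "\<exists>T. cframe \<mu> J 0 1 0 (-\<i>) 0 T"
        using cframe_triangular[OF lie abelian dim frame2 one(1) nz, of 0 0 0] nz(2) by auto
      thus ?thesis ..
    qed
  qed
qed

end

section \<open>The exceptional pair\<close>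

lemma index6_cases: "i = 1 \<or> i = 2 \<or> i = 3 \<or> i = 4 \<or> i = 5 \<or> i = 6" for i :: 6
proof (induct i)
  case (of_int z)
  then have "z = 0 \<or> z = 1 \<or> z = 2 \<or> z = 3 \<or> z = 4 \<or> z = 5" by auto
  then show ?case by auto
qed

definition cvec_to_R6 :: "cvec \<Rightarrow> real^6" where
  "cvec_to_R6 x = Re (fst x) *\<^sub>R axis 1 1 + Im (fst x) *\<^sub>R axis 2 1
    + Re (fst (snd x)) *\<^sub>R axis 3 1 + Im (fst (snd x)) *\<^sub>R axis 4 1
    + Re (snd (snd x)) *\<^sub>R axis 5 1 + Im (snd (snd x)) *\<^sub>R axis 6 1"

lemma cvec_to_R6_nth:
  "cvec_to_R6 x $ 1 = Re (fst x)" "cvec_to_R6 x $ 2 = Im (fst x)"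
  "cvec_to_R6 x $ 3 = Re (fst (snd x))" "cvec_to_R6 x $ 4 = Im (fst (snd x))"
  "cvec_to_R6 x $ 5 = Re (snd (snd x))" "cvec_to_R6 x $ 6 = Im (snd (snd x))"
  by (simp_all add: cvec_to_R6_def axis_def)

text \<open>The vectors e1, e3, e5 form the complex basis. The bracket of e1 and e2 gives the
  parameter 1, that of e1 and e4 gives \<open>-\<i>\<close>, and the other two parameters in the
  third coordinate vanish.\<close>

lemma cframe_mu5: "cframe mu5 J5 0 1 0 (-\<i>) 0 cvec_to_R6"
  unfolding cframe_def
proof (intro conjI allI)
  show "linear cvec_to_R6"
    by (rule linearI) (simp_all add: cvec_to_R6_def algebra_simps)
  show "bij cvec_to_R6"
  proof (rule o_bij)
    let ?S = "\<lambda>x :: real^6. (Complex (x$1) (x$2), Complex (x$3) (x$4), Complex (x$5) (x$6))"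
    show "?S \<circ> cvec_to_R6 = id"
      by (auto simp: cvec_to_R6_nth)
    show "cvec_to_R6 \<circ> ?S = id"
    proof
      fix x :: "real^6"
      show "(cvec_to_R6 \<circ> ?S) x = id x"
        unfolding vec_eq_iff
      proof
        show "(cvec_to_R6 \<circ> ?S) x $ i = id x $ i" for i
          using index6_cases[of i] by (elim disjE) (simp_all add: cvec_to_R6_nth)
      qed
    qed
  qed
  show "cvec_to_R6 (times_i x) = J5 (cvec_to_R6 x)" for x
    unfolding J5_def cvec_to_R6_nth by (simp add: cvec_to_R6_def times_i_def)
  show "mu5 (cvec_to_R6 x) (cvec_to_R6 y) = cvec_to_R6 (cbracket 0 1 0 (- \<i>) 0 x y)" for x y
    unfolding mu5_def cvec_to_R6_nth
    by (simp add: cvec_to_R6_def cbracket_def Let_def algebra_simps)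
qed

text \<open>Composition with \<open>cvec_to_R6\<close> turns inverses of isomorphisms onto the
  exceptional pair into frames with its parameters, and conversely.\<close>

lemma holomorphically_isomorphic_mu5_iff:
  fixes \<mu> :: "'a::euclidean_space \<Rightarrow> 'a \<Rightarrow> 'a"
  shows "holomorphically_isomorphic \<mu> J mu5 J5 \<longleftrightarrow> (\<exists>T. cframe \<mu> J 0 1 0 (-\<i>) 0 T)"
proof
  let ?S = cvec_to_R6
  let ?m = "cbracket 0 1 0 (-\<i>) 0"
  have S: "linear ?S" "bij ?S" and SJ: "?S (times_i x) = J5 (?S x)"
    and Sm: "mu5 (?S x) (?S y) = ?S (?m x y)" for x y
    using cframe_mu5 unfolding cframe_def by blast+
  {
    assume "holomorphically_isomorphic \<mu> J mu5 J5"
    then obtain \<phi> where \<phi>: "linear \<phi>" "bij \<phi>" and \<phi>m: "\<And>x y. \<phi> (\<mu> x y) = mu5 (\<phi> x) (\<phi> y)"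
      and \<phi>J: "J5 = \<phi> \<circ> J \<circ> inv \<phi>"
      unfolding holomorphically_isomorphic_def by blast
    have inv: "inv \<phi> (\<phi> x) = x" "\<phi> (inv \<phi> y) = y" for x y
      using \<phi>(2) by (simp_all add: bij_is_inj bij_is_surj surj_f_inv_f)
    have "cframe \<mu> J 0 1 0 (-\<i>) 0 (inv \<phi> \<circ> ?S)"
      unfolding cframe_def
    proof (intro conjI allI)
      show "linear (inv \<phi> \<circ> ?S)" using linear_compose[OF S(1) linear_inv[OF \<phi>]] .
      show "bij (inv \<phi> \<circ> ?S)" using bij_comp[OF S(2) bij_imp_bij_inv[OF \<phi>(2)]] .
      show "(inv \<phi> \<circ> ?S) (times_i x) = J ((inv \<phi> \<circ> ?S) x)" for x
        by (simp add: SJ \<phi>J inv)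
      show "\<mu> ((inv \<phi> \<circ> ?S) x) ((inv \<phi> \<circ> ?S) y) = (inv \<phi> \<circ> ?S) (?m x y)" for x y
        using inv(1)[of "\<mu> (inv \<phi> (?S x)) (inv \<phi> (?S y))"] by (simp add: \<phi>m inv Sm)
    qed
    thus "\<exists>T. cframe \<mu> J 0 1 0 (-\<i>) 0 T" by blast
  }
  {
    assume "\<exists>T. cframe \<mu> J 0 1 0 (-\<i>) 0 T"
    then obtain T where T: "linear T" "bij T" and TJ: "\<And>x. T (times_i x) = J (T x)"
      and Tm: "\<And>x y. \<mu> (T x) (T y) = T (?m x y)"
      unfolding cframe_def by blast
    have inv: "inv T (T x) = x" "T (inv T y) = y" for x y
      using T(2) by (simp_all add: bij_is_inj bij_is_surj surj_f_inv_f)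
    let ?\<phi> = "?S \<circ> inv T"
    have lin: "linear ?\<phi>" using linear_compose[OF linear_inv[OF T] S(1)] .
    have bij: "bij ?\<phi>" using bij_comp[OF bij_imp_bij_inv[OF T(2)] S(2)] .
    have br: "?\<phi> (\<mu> x y) = mu5 (?\<phi> x) (?\<phi> y)" for x y
      using Tm[of "inv T x" "inv T y"] by (simp add: inv Sm)
    have J: "?\<phi> (J x) = J5 (?\<phi> x)" for x
      using TJ[of "inv T x"] inv(1)[of "times_i (inv T x)"] by (simp add: inv flip: SJ)
    have "J5 = ?\<phi> \<circ> J \<circ> inv ?\<phi>"
    proof
      fix y
      have "?\<phi> (inv ?\<phi> y) = y" using bij by (meson bij_is_surj surj_f_inv_f)
      thus "J5 y = (?\<phi> \<circ> J \<circ> inv ?\<phi>) y" using J[of "inv ?\<phi> y"] by simp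
    qed
    thus "holomorphically_isomorphic \<mu> J mu5 J5"
      unfolding holomorphically_isomorphic_def using lin bij br by blast
  }
qed

theorem theorem4p4:
  fixes \<mu> :: "'a::euclidean_space \<Rightarrow> 'a \<Rightarrow> 'a" and J' :: "'a \<Rightarrow> 'a"
  assumes "DIM('a) = 6"
    and "nilpotent_lie_bracket \<mu>"
    and "abelian_complex_structure \<mu> J'"
  shows "(\<exists>g. minimal_metric \<mu> J' g) \<longleftrightarrow> \<not> holomorphically_isomorphic \<mu> J' mu5 J5"
  unfolding holomorphically_isomorphic_mu5_iff
proof
  note dim = assms(1) and J = assms(3)
  have lie: "lie_bracket \<mu>" using assms(2) by (simp add: nilpotent_lie_bracket_def)
  show "\<nexists>T. cframe \<mu> J' 0 1 0 (-\<i>) 0 T" if "\<exists>g. minimal_metric \<mu> J' g"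
    using that no_minimal_metric_exceptional[OF lie J dim] by blast
  assume not5: "\<nexists>T. cframe \<mu> J' 0 1 0 (-\<i>) 0 T"
  obtain \<alpha> \<gamma> a b c T where frame: "cframe \<mu> J' \<alpha> \<gamma> a b c T" and \<alpha>c: "\<alpha> = 0 \<or> c = 0"
    by (rule nilpotent_cframe[OF assms(2) J dim])
  show "\<exists>g. minimal_metric \<mu> J' g"
  proof (cases "\<alpha> = 0")
    case True
    obtain \<gamma>' a' b' c' T' where frame': "cframe \<mu> J' 0 \<gamma>' a' b' c' T'" and n: "c' = 0 \<or> a' = 0 \<and> b' = 0"
      using two_step_normal_form[OF lie J dim frame[unfolded True]] by blast
    consider "c' = 0" | "\<gamma>' = 0" "a' = 0" "b' = 0" | "\<gamma>' \<noteq> 0" "c' \<noteq> 0" "a' = 0" "b' = 0" using n by blast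
    thus ?thesis
    proof cases
      case 1
      thus ?thesis using minimal_metric_or_exceptional[OF lie J dim] frame' not5 by blast
    next
      case 2
      \<comment> \<open>Exchanging the two generators turns \<open>c\<close> into \<open>\<gamma>\<close>.\<close>
      have "\<exists>T. cframe \<mu> J' 0 c' 0 0 0 T"
        using cframe_change_generators[OF lie J dim frame', of 0 0 1 1] 2
        by (simp add: cbracket_def Let_def times_i_def)
      thus ?thesis using minimal_metric_abelian_or_heisenberg[OF lie J dim] by blast
    next
      case 3
      \<comment> \<open>Scaling the first vector by \<open>r\<close> multiplies
        \<open>\<gamma>'\<close> by \<open>r\<^sup>2\<close> and keeps \<open>c'\<close>, so this
        choice makes their moduli equal.\<close>
      define r where "r = sqrt (norm c' / norm \<gamma>')"
      have r: "r \<noteq> 0" "r\<^sup>2 = norm c' / norm \<gamma>'" using 3 by (simp_all add: r_def)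
      have one: "(1::complex) \<noteq> 0" by simp
      obtain T2 where frame2: "cframe \<mu> J' 0 (r\<^sup>2 *\<^sub>R \<gamma>') 0 0 c' T2"
        using cframe_triangular[OF lie J dim frame' r(1) one one, of 0 0 0] 3 by auto
      have "norm (r\<^sup>2 *\<^sub>R \<gamma>') = norm c'" using 3 by (simp add: r(2))
      from minimal_metric_balanced[OF lie J dim frame2 this] show ?thesis by simp
    qed
  next
    case False
    hence c: "c = 0" using \<alpha>c by simp
    show ?thesis
    proof (cases "a = 0 \<and> b = 0")
      case True
      \<comment> \<open>The bracket takes values in the central complex line through \<open>(0, \<alpha>, \<gamma>)\<close>.\<close>
      have "cframe \<mu> J' 0 1 0 0 0 (T \<circ> cmap times_i (1, 0, 0) (0, 0, 1) (0, \<alpha>, \<gamma>))"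
        by (rule cframe_change[OF lie J dim frame])
          (use False True in \<open>auto simp: c cbracket_def Let_def times_i_def cmap_times_i_apply zero_prod_def\<close>)
      thus ?thesis using minimal_metric_abelian_or_heisenberg[OF lie J dim] by blast
    next
      case ab: False
      thus ?thesis using minimal_metric_three_step[OF lie J dim frame[unfolded c] False] by blast
    qed
  qed
qed

end
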